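(* Suppose $\gamma^{m-2}>\kappa$ and $m\ge 4$. Let $\{\Pi^n=(f^n,g^n,a^n)\}_{n\ge1}$ be a sequence of parsimonious protocols on $M=\{1,\dots,m\}$ with $\lim_{n\to\infty}U^R(\Pi^n)=\sup_\Pi U^R(\Pi)$, where for each $n$ the initial distribution $g^n$ is supported on the transient states and every transient state has a positive expected number of visits before absorption. For each $n$, label the absorbing states $1$ (with $a^n(1)=0$) and $m$ (with $a^n(m)=1$), and label the transient states $2,\dots,m-1$ so that $\nu^H_2(\Pi^n)/\nu^L_2(\Pi^n)\le\cdots\le\nu^H_{m-1}(\Pi^n)/\nu^L_{m-1}(\Pi^n)$ (ties broken arbitrarily). Then, as $n\to\infty$: (i) for each $\theta\in\{H,L\}$, \[\mathrm P^\theta\big(m_{\tau^\theta(\Pi^n)-1}=2,\ s_{\tau^\theta(\Pi^n)-1}=l \,\big|\, m_{\tau^\theta(\Pi^n)}=1\big)\to 1,\] \[\mathrm P^\theta\big(m_{\tau^\theta(\Pi^n)-1}=m-1,\ s_{\tau^\theta(\Pi^n)-1}=h \,\big|\, m_{\tau^\theta(\Pi^n)}=m\big)\to 1;\] (ii) $f^n(i,s)(\{1,m\})\to 0$ for every transient state $i\in\{2,\dots,m-1\}$ and every $s\in S$.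
   Context: Setting. The state of nature is $\theta\in\Theta=\{H,L\}$ with prior $\Pr(\theta=H)=p\in(0,1)$. A sender privately observes $\theta$; a receiver does not. $S$ is a finite signal set; conditional on $\theta$, signals are i.i.d. with distribution $\pi_\theta$ on $S$, where $\pi_\theta(s)>0$ for all $s\in S,\theta\in\Theta$, and $\pi_H\neq\pi_L$. The receiver has the set of memory states $M=\{1,\dots,m\}$ and chooses a protocol $\Pi=(f,g,a)$: a transition function $f:M\times S\to\Delta(M)$ ($f(i,s)(j)$ is the probability of moving from memory state $i$ to $j$ after signal $s$), an initial distribution $g\in\Delta(M)$ of $m_0$, and an action rule $a:M\to[0,1]$ (probability of action $H$ if the game ends in that memory state). A sender strategy is $\sigma:M\times\Theta\to[0,1]$, the probability of stopping in the current memory state given $\theta$. Timing: $m_0\sim g$; in each period $t=0,1,\dots$, with current memory state $m_t$, the game ends if $m_t$ is absorbing ($f(m_t,s)(m_t)=1$ for all $s$); otherwise the sender stops with probability $\sigma(m_t,\theta)$, ending the game; if not stopped, a signal $s_t\sim\pi_\theta$ is generated and $m_{t+1}\sim f(m_t,s_t)$. When the game ends in state $m_t$ the receiver takes action $H$ with probability $a(m_t)$ and $L$ otherwise. The receiver's payoff is $1$ if the action equals $\theta$ and $0$ otherwise; the sender's payoff is $1$ if the action is $H$ and $0$ otherwise; there is no discounting; if the game never ends both get $0$. $U^R(\Pi,\sigma)$ is the receiver's expected payoff, $\mathrm{br}(\Pi)$ the set of sender best responses, and $U^R(\Pi):=U^R(\Pi,\sigma)$ for $\sigma\in\mathrm{br}(\Pi)$;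 $\sup_\Pi$ is over all protocols on $M$. A protocol is parsimonious if (i) it has exactly two absorbing memory states, one in which $a=0$ and one in which $a=1$, and (ii) all other memory states are transient with $a=0$ (absorbing/transient refer to the Markov chain on $M$ induced by $f$ with signals drawn from $\pi_\theta$; by full support this classification does not depend on $\theta$). Under a parsimonious protocol the sender keeps sending signals until absorption; $\mathrm P^\theta$ denotes probability for this process (memory states $m_t$, signals $s_t\sim\pi_\theta$ i.i.d.) when the state of nature is $\theta$, and $\tau^\theta(\Pi)$ is the first time $t$ with $m_t\in\{1,m\}$. Relative hitting frequency: for a transient state $i$, $\nu^\theta_i(\Pi)=\mathbb E^\theta[\#\{t<\tau^\theta(\Pi): m_t=i\}]/\mathbb E^\theta[\tau^\theta(\Pi)]$. $\bar\ell=\max_{s}\pi_H(s)/\pi_L(s)$, $\underline\ell=\min_{s}\pi_H(s)/\pi_L(s)$, $\gamma=\bar\ell/\underline\ell$; $h$ denotes a signal with $\pi_H(h)/\pi_L(h)=\bar\ell$ and $l$ a signal with $\pi_H(l)/\pi_L(l)=\underline\ell$ (signals with the same likelihood ratio are identified). $\kappa=\max\{p/(1-p),(1-p)/p\}$. *)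

theory Defs
  imports Complex_Main
begin

datatype theta = H | L

text \<open>Memory states M = {1..m}. A protocol is a triple (f, g, a) with
  f :: nat => 's => nat => real  (f i s j = probability of moving i -> j after signal s),
  g :: nat => real               (initial distribution),
  a :: nat => real               (probability of action H when ending in a state).
  Signals form a finite type 's; pi th s is the signal distribution given th.\<close>

definition is_protocol ::
  "nat \<Rightarrow> (nat \<Rightarrow> 's::finite \<Rightarrow> nat \<Rightarrow> real) \<Rightarrow> (nat \<Rightarrow> real) \<Rightarrow> (nat \<Rightarrow> real) \<Rightarrow> bool" where
  "is_protocol m f g a \<longleftrightarrow>
     (\<forall>i\<in>{1..m}. \<forall>s. (\<forall>j. f i s j \<ge> 0) \<and> (\<forall>j. j \<notin> {1..m} \<longrightarrow> f i s j = 0)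
                       \<and> (\<Sum>j=1..m. f i s j) = 1) \<and>
     (\<forall>j. g j \<ge> 0) \<and> (\<forall>j. j \<notin> {1..m} \<longrightarrow> g j = 0) \<and> (\<Sum>j=1..m. g j) = 1 \<and>
     (\<forall>i\<in>{1..m}. 0 \<le> a i \<and> a i \<le> 1)"

definition absorbing :: "nat \<Rightarrow> (nat \<Rightarrow> 's::finite \<Rightarrow> nat \<Rightarrow> real) \<Rightarrow> nat \<Rightarrow> bool" where
  "absorbing m f i \<longleftrightarrow> i \<in> {1..m} \<and> (\<forall>s. f i s i = 1)"

definition trans_prob ::
  "(theta \<Rightarrow> 's::finite \<Rightarrow> real) \<Rightarrow> theta \<Rightarrow> (nat \<Rightarrow> 's \<Rightarrow> nat \<Rightarrow> real) \<Rightarrow> nat \<Rightarrow> nat \<Rightarrow> real" where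
  "trans_prob \<pi> th f i j = (\<Sum>s\<in>UNIV. \<pi> th s * f i s j)"

definition reach ::
  "nat \<Rightarrow> (theta \<Rightarrow> 's::finite \<Rightarrow> real) \<Rightarrow> theta \<Rightarrow> (nat \<Rightarrow> 's \<Rightarrow> nat \<Rightarrow> real) \<Rightarrow> nat \<Rightarrow> nat \<Rightarrow> bool" where
  "reach m \<pi> th f = (\<lambda>i j. i \<in> {1..m} \<and> j \<in> {1..m} \<and> trans_prob \<pi> th f i j > 0)\<^sup>*\<^sup>*"

definition transient ::
  "nat \<Rightarrow> (theta \<Rightarrow> 's::finite \<Rightarrow> real) \<Rightarrow> theta \<Rightarrow> (nat \<Rightarrow> 's \<Rightarrow> nat \<Rightarrow> real) \<Rightarrow> nat \<Rightarrow> bool" where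
  "transient m \<pi> th f i \<longleftrightarrow> i \<in> {1..m} \<and>
     (\<exists>j\<in>{1..m}. reach m \<pi> th f i j \<and> \<not> reach m \<pi> th f j i)"

definition parsimonious ::
  "nat \<Rightarrow> (theta \<Rightarrow> 's::finite \<Rightarrow> real) \<Rightarrow> (nat \<Rightarrow> 's \<Rightarrow> nat \<Rightarrow> real) \<Rightarrow> (nat \<Rightarrow> real) \<Rightarrow> bool" where
  "parsimonious m \<pi> f a \<longleftrightarrow>
     (\<exists>a0 a1. a0 \<noteq> a1 \<and> absorbing m f a0 \<and> absorbing m f a1 \<and> a a0 = 0 \<and> a a1 = 1 \<and>
        (\<forall>i\<in>{1..m}. absorbing m f i \<longrightarrow> i = a0 \<or> i = a1) \<and>
        (\<forall>i\<in>{1..m} - {a0, a1}. (\<forall>th. transient m \<pi> th f i) \<and> a i = 0))"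

text \<open>reach_prob m pi th f g a sigma t i = probability that period t is reached (game not
  ended before t) with memory state m_t = i.\<close>
fun reach_prob ::
  "nat \<Rightarrow> (theta \<Rightarrow> 's::finite \<Rightarrow> real) \<Rightarrow> theta \<Rightarrow> (nat \<Rightarrow> 's \<Rightarrow> nat \<Rightarrow> real) \<Rightarrow> (nat \<Rightarrow> real)
     \<Rightarrow> (nat \<Rightarrow> theta \<Rightarrow> real) \<Rightarrow> nat \<Rightarrow> nat \<Rightarrow> real" where
  "reach_prob m \<pi> th f g \<sigma> 0 j = (if j \<in> {1..m} then g j else 0)"
| "reach_prob m \<pi> th f g \<sigma> (Suc t) j =
     (\<Sum>i\<in>{i\<in>{1..m}. \<not> absorbing m f i}.
        reach_prob m \<pi> th f g \<sigma> t i * (1 - \<sigma> i th) * (\<Sum>s\<in>UNIV. \<pi> th s * f i s j))"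

definition end_prob ::
  "nat \<Rightarrow> (theta \<Rightarrow> 's::finite \<Rightarrow> real) \<Rightarrow> theta \<Rightarrow> (nat \<Rightarrow> 's \<Rightarrow> nat \<Rightarrow> real) \<Rightarrow> (nat \<Rightarrow> real)
     \<Rightarrow> (nat \<Rightarrow> theta \<Rightarrow> real) \<Rightarrow> nat \<Rightarrow> nat \<Rightarrow> real" where
  "end_prob m \<pi> th f g \<sigma> t i =
     reach_prob m \<pi> th f g \<sigma> t i * (if absorbing m f i then 1 else \<sigma> i th)"

definition prob_actH ::
  "nat \<Rightarrow> (theta \<Rightarrow> 's::finite \<Rightarrow> real) \<Rightarrow> theta \<Rightarrow> (nat \<Rightarrow> 's \<Rightarrow> nat \<Rightarrow> real) \<Rightarrow> (nat \<Rightarrow> real)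
     \<Rightarrow> (nat \<Rightarrow> real) \<Rightarrow> (nat \<Rightarrow> theta \<Rightarrow> real) \<Rightarrow> real" where
  "prob_actH m \<pi> th f g a \<sigma> =
     (\<Sum>t. \<Sum>i=1..m. end_prob m \<pi> th f g \<sigma> t i * a i)"

definition prob_actL ::
  "nat \<Rightarrow> (theta \<Rightarrow> 's::finite \<Rightarrow> real) \<Rightarrow> theta \<Rightarrow> (nat \<Rightarrow> 's \<Rightarrow> nat \<Rightarrow> real) \<Rightarrow> (nat \<Rightarrow> real)
     \<Rightarrow> (nat \<Rightarrow> real) \<Rightarrow> (nat \<Rightarrow> theta \<Rightarrow> real) \<Rightarrow> real" where
  "prob_actL m \<pi> th f g a \<sigma> =
     (\<Sum>t. \<Sum>i=1..m. end_prob m \<pi> th f g \<sigma> t i * (1 - a i))"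

definition U_S ::
  "nat \<Rightarrow> real \<Rightarrow> (theta \<Rightarrow> 's::finite \<Rightarrow> real) \<Rightarrow> (nat \<Rightarrow> 's \<Rightarrow> nat \<Rightarrow> real) \<Rightarrow> (nat \<Rightarrow> real)
     \<Rightarrow> (nat \<Rightarrow> real) \<Rightarrow> (nat \<Rightarrow> theta \<Rightarrow> real) \<Rightarrow> real" where
  "U_S m p \<pi> f g a \<sigma> = p * prob_actH m \<pi> H f g a \<sigma> + (1 - p) * prob_actH m \<pi> L f g a \<sigma>"

definition U_R_strat ::
  "nat \<Rightarrow> real \<Rightarrow> (theta \<Rightarrow> 's::finite \<Rightarrow> real) \<Rightarrow> (nat \<Rightarrow> 's \<Rightarrow> nat \<Rightarrow> real) \<Rightarrow> (nat \<Rightarrow> real)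
     \<Rightarrow> (nat \<Rightarrow> real) \<Rightarrow> (nat \<Rightarrow> theta \<Rightarrow> real) \<Rightarrow> real" where
  "U_R_strat m p \<pi> f g a \<sigma> = p * prob_actH m \<pi> H f g a \<sigma> + (1 - p) * prob_actL m \<pi> L f g a \<sigma>"

definition sender_strategy :: "(nat \<Rightarrow> theta \<Rightarrow> real) \<Rightarrow> bool" where
  "sender_strategy \<sigma> \<longleftrightarrow> (\<forall>i th. 0 \<le> \<sigma> i th \<and> \<sigma> i th \<le> 1)"

definition br ::
  "nat \<Rightarrow> real \<Rightarrow> (theta \<Rightarrow> 's::finite \<Rightarrow> real) \<Rightarrow> (nat \<Rightarrow> 's \<Rightarrow> nat \<Rightarrow> real) \<Rightarrow> (nat \<Rightarrow> real)
     \<Rightarrow> (nat \<Rightarrow> real) \<Rightarrow> (nat \<Rightarrow> theta \<Rightarrow> real) set" where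
  "br m p \<pi> f g a = {\<sigma>. sender_strategy \<sigma> \<and>
      (\<forall>\<sigma>'. sender_strategy \<sigma>' \<longrightarrow> U_S m p \<pi> f g a \<sigma>' \<le> U_S m p \<pi> f g a \<sigma>)}"

definition U_R ::
  "nat \<Rightarrow> real \<Rightarrow> (theta \<Rightarrow> 's::finite \<Rightarrow> real) \<Rightarrow> (nat \<Rightarrow> 's \<Rightarrow> nat \<Rightarrow> real) \<Rightarrow> (nat \<Rightarrow> real)
     \<Rightarrow> (nat \<Rightarrow> real) \<Rightarrow> real" where
  "U_R m p \<pi> f g a = (SUP \<sigma>\<in>br m p \<pi> f g a. U_R_strat m p \<pi> f g a \<sigma>)"

definition sup_U_R :: "nat \<Rightarrow> real \<Rightarrow> (theta \<Rightarrow> 's::finite \<Rightarrow> real) \<Rightarrow> real" where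
  "sup_U_R m p \<pi> = Sup {U_R m p \<pi> f g a | f g a. is_protocol m f g a}"

text \<open>alive_prob m pi th f g t i = P^th(m_0, ..., m_t all in {2..m-1}, m_t = i), i.e.
  P^th(t < tau, m_t = i).\<close>
fun alive_prob ::
  "nat \<Rightarrow> (theta \<Rightarrow> 's::finite \<Rightarrow> real) \<Rightarrow> theta \<Rightarrow> (nat \<Rightarrow> 's \<Rightarrow> nat \<Rightarrow> real) \<Rightarrow> (nat \<Rightarrow> real)
     \<Rightarrow> nat \<Rightarrow> nat \<Rightarrow> real" where
  "alive_prob m \<pi> th f g 0 j = (if j \<in> {2..m-1} then g j else 0)"
| "alive_prob m \<pi> th f g (Suc t) j =
     (if j \<in> {2..m-1} then
        (\<Sum>i=2..m-1. alive_prob m \<pi> th f g t i * (\<Sum>s\<in>UNIV. \<pi> th s * f i s j))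
      else 0)"

definition exp_visits ::
  "nat \<Rightarrow> (theta \<Rightarrow> 's::finite \<Rightarrow> real) \<Rightarrow> theta \<Rightarrow> (nat \<Rightarrow> 's \<Rightarrow> nat \<Rightarrow> real) \<Rightarrow> (nat \<Rightarrow> real)
     \<Rightarrow> nat \<Rightarrow> real" where
  "exp_visits m \<pi> th f g i = (\<Sum>t. alive_prob m \<pi> th f g t i)"

text \<open>E^th[tau] = sum over t of P^th(tau > t).\<close>
definition exp_tau ::
  "nat \<Rightarrow> (theta \<Rightarrow> 's::finite \<Rightarrow> real) \<Rightarrow> theta \<Rightarrow> (nat \<Rightarrow> 's \<Rightarrow> nat \<Rightarrow> real) \<Rightarrow> (nat \<Rightarrow> real) \<Rightarrow> real" where
  "exp_tau m \<pi> th f g = (\<Sum>t. \<Sum>i=2..m-1. alive_prob m \<pi> th f g t i)"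

definition nu ::
  "nat \<Rightarrow> (theta \<Rightarrow> 's::finite \<Rightarrow> real) \<Rightarrow> theta \<Rightarrow> (nat \<Rightarrow> 's \<Rightarrow> nat \<Rightarrow> real) \<Rightarrow> (nat \<Rightarrow> real)
     \<Rightarrow> nat \<Rightarrow> real" where
  "nu m \<pi> th f g i = exp_visits m \<pi> th f g i / exp_tau m \<pi> th f g"

text \<open>P^th(m_{tau-1} = i, s_{tau-1} \<in> SS, m_tau = j), tau \<ge> 1:
  sum over t of P^th(tau = t+1, m_t = i, s_t \<in> SS, m_{t+1} = j).\<close>
definition last_step_prob ::
  "nat \<Rightarrow> (theta \<Rightarrow> 's::finite \<Rightarrow> real) \<Rightarrow> theta \<Rightarrow> (nat \<Rightarrow> 's \<Rightarrow> nat \<Rightarrow> real) \<Rightarrow> (nat \<Rightarrow> real)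
     \<Rightarrow> nat \<Rightarrow> 's set \<Rightarrow> nat \<Rightarrow> real" where
  "last_step_prob m \<pi> th f g i SS j =
     (if j \<in> {1, m} then (\<Sum>t. \<Sum>s\<in>SS. alive_prob m \<pi> th f g t i * \<pi> th s * f i s j) else 0)"

definition absorb_prob ::
  "nat \<Rightarrow> (theta \<Rightarrow> 's::finite \<Rightarrow> real) \<Rightarrow> theta \<Rightarrow> (nat \<Rightarrow> 's \<Rightarrow> nat \<Rightarrow> real) \<Rightarrow> (nat \<Rightarrow> real)
     \<Rightarrow> nat \<Rightarrow> real" where
  "absorb_prob m \<pi> th f g j =
     g j + (\<Sum>t. \<Sum>i=2..m-1. \<Sum>s\<in>UNIV. alive_prob m \<pi> th f g t i * \<pi> th s * f i s j)"

definition lratio :: "(theta \<Rightarrow> 's::finite \<Rightarrow> real) \<Rightarrow> 's \<Rightarrow> real" where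
  "lratio \<pi> s = \<pi> H s / \<pi> L s"

definition lbar :: "(theta \<Rightarrow> 's::finite \<Rightarrow> real) \<Rightarrow> real" where
  "lbar \<pi> = Max (range (lratio \<pi>))"

definition lunder :: "(theta \<Rightarrow> 's::finite \<Rightarrow> real) \<Rightarrow> real" where
  "lunder \<pi> = Min (range (lratio \<pi>))"

definition gamma :: "(theta \<Rightarrow> 's::finite \<Rightarrow> real) \<Rightarrow> real" where
  "gamma \<pi> = lbar \<pi> / lunder \<pi>"

definition kappa :: "real \<Rightarrow> real" where
  "kappa p = max (p / (1 - p)) ((1 - p) / p)"

text \<open>Signals h (maximal likelihood ratio) and l (minimal); signals with the same ratio
  are identified, so "s = h" means s belongs to hsig.\<close>
definition hsig :: "(theta \<Rightarrow> 's::finite \<Rightarrow> real) \<Rightarrow> 's set" where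
  "hsig \<pi> = {s. lratio \<pi> s = lbar \<pi>}"

definition lsig :: "(theta \<Rightarrow> 's::finite \<Rightarrow> real) \<Rightarrow> 's set" where
  "lsig \<pi> = {s. lratio \<pi> s = lunder \<pi>}"

end

theory Submission
  imports Defs
begin

text \<open>
  Never stopping is a best response to a parsimonious protocol, so the receiver's payoff is determined by
  the absorption probabilities. Sending absorbed paths back to the initial distribution makes the expected
  visits a stationary measure, and flow balance across the cut between \<open>{2..k}\<close> and \<open>{k+1..m-1}\<close> bounds the
  quotient of consecutive visit ratios by \<open>\<gamma>\<close> (the Hellman-Cover argument). Together with the last step before
  absorption this bounds the odds product by \<open>\<gamma>^(m-2)\<close>, and birth-death walks with rare exits approach the
  bound. Near-optimality makes all these inequalities nearly tight. Hence absorption in 1 comes from state 2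
  with signal l, absorption in \<open>m\<close> from state \<open>m-1\<close> with signal h, and the upward flow across each cut
  concentrates on signal h, the downward flow on signal l. A restart after absorption in 1 that lands above the
  cut is an upward move with signal l, and one after absorption in \<open>m\<close> that lands below it is a downward move
  with signal h; both must be negligible, while together with probability bounded away from 0 one of them
  occurs. So all flows, and with them all expected numbers of visits, tend to infinity, which forces the exit
  probabilities to 0.
\<close>

text \<open>One quantity ties the estimates together: a visit to \<open>i\<close> followed by signal
  \<open>s\<close> is \<open>r i * lratio \<pi> s\<close> times as frequent under \<open>H\<close>
  as under \<open>L\<close>. Every flow bound compares the two states of nature on a set of such
  pairs, and it is tight only if the mass sits on the extreme pairs. The odds bound is a product of
  estimates of this kind that hold anyway, so a single defect factor \<open>\<eta>\<close> for the
  product also bounds the defect of each factor. Finiteness of the signal set supplies a gap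
  \<open>C > 1\<close> that turns a small defect into concentration. The condition on \<kappa>
  enters through the error probabilities: a near-optimal payoff yields near-tight odds because the
  expected error has a unique minimizer under the odds bound, and \<kappa> < \<gamma>^(m-2) places
  it strictly inside the unit square. This also keeps the absorption probabilities away from 0,
  which both the conditioning and the growth of the flows require. The assumption
  \<open>m \<ge> 4\<close> provides at least one cut, and all control of the visits starts from
  cuts.\<close>

declare One_nat_def [simp del]

section \<open>Finite sums and payoff bounds for arbitrary protocols\<close>

lemma sum_split_ends:
  fixes h :: "nat \<Rightarrow> 'a::comm_monoid_add"
  assumes "2 \<le> m"
  shows "(\<Sum>j=1..m. h j) = h 1 + (h m + (\<Sum>j=2..m-1. h j))"
proof -
  have "{1..m} = insert 1 (insert m {2..m-1})"
    using assms by auto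
  then show ?thesis
    using assms by simp
qed

lemma sum_Un_parts:
  fixes h :: "'a \<Rightarrow> real"
  assumes "finite T" "A \<subseteq> T"
  shows "sum h T = sum h A + sum h (T - A)"
  using assms by (metis add.commute sum.subset_diff)

lemma reach_prob_nonneg:
  assumes "is_protocol m f g a" "\<And>th s. 0 < \<pi> th s" "sender_strategy \<sigma>"
  shows "0 \<le> reach_prob m \<pi> th f g \<sigma> t j"
proof (induction t arbitrary: j)
  case 0
  then show ?case
    using assms(1) by (simp add: is_protocol_def)
next
  case (Suc t)
  have "0 \<le> f i s j" if "i \<in> {1..m}" for i s
    using assms(1) that by (auto simp: is_protocol_def)
  moreover have "0 \<le> 1 - \<sigma> i th" for i
    using assms(3) by (simp add: sender_strategy_def)
  ultimately show ?case
    using Suc assms(2) by (auto intro!: sum_nonneg mult_nonneg_nonneg simp: less_imp_le)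
qed

lemma end_prob_nonneg:
  assumes "is_protocol m f g a" "\<And>th s. 0 < \<pi> th s" "sender_strategy \<sigma>"
  shows "0 \<le> end_prob m \<pi> th f g \<sigma> t i"
  using reach_prob_nonneg[OF assms] assms(3)
  by (simp add: end_prob_def sender_strategy_def)

text \<open>Conservation of probability: rows of \<open>f\<close> sum to 1, so mass disappears only
  when the game ends. Telescoping this bounds the total probability of ending.\<close>

lemma sum_reach_prob_Suc:
  assumes "is_protocol m f g a" "\<And>th. (\<Sum>s\<in>UNIV. \<pi> th s) = 1"
  shows "(\<Sum>j=1..m. reach_prob m \<pi> th f g \<sigma> (Suc t) j)
    = (\<Sum>j=1..m. reach_prob m \<pi> th f g \<sigma> t j) - (\<Sum>i=1..m. end_prob m \<pi> th f g \<sigma> t i)"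
proof -
  let ?r = "reach_prob m \<pi> th f g \<sigma> t"
  let ?N = "{i\<in>{1..m}. \<not> absorbing m f i}"
  have one: "(\<Sum>j=1..m. \<Sum>s\<in>UNIV. \<pi> th s * f i s j) = 1" if "i \<in> {1..m}" for i
  proof -
    have "(\<Sum>j=1..m. \<Sum>s\<in>UNIV. \<pi> th s * f i s j) = (\<Sum>s\<in>UNIV. \<pi> th s * (\<Sum>j=1..m. f i s j))"
      by (subst sum.swap) (simp add: sum_distrib_left)
    also have "\<dots> = 1"
      using assms that by (simp add: is_protocol_def)
    finally show ?thesis .
  qed
  have "(\<Sum>j=1..m. reach_prob m \<pi> th f g \<sigma> (Suc t) j)
      = (\<Sum>i\<in>?N. ?r i * (1 - \<sigma> i th) * (\<Sum>j=1..m. \<Sum>s\<in>UNIV. \<pi> th s * f i s j))"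
    unfolding reach_prob.simps by (subst sum.swap) (simp add: sum_distrib_left)
  also have "\<dots> = (\<Sum>i\<in>?N. ?r i * (1 - \<sigma> i th))"
    by (rule sum.cong) (auto simp: one)
  also have "\<dots> = (\<Sum>i=1..m. if \<not> absorbing m f i then ?r i * (1 - \<sigma> i th) else 0)"
    by (rule sum.inter_filter) simp
  also have "\<dots> = (\<Sum>i=1..m. ?r i - end_prob m \<pi> th f g \<sigma> t i)"
    by (rule sum.cong) (auto simp: end_prob_def algebra_simps)
  finally show ?thesis
    by (simp add: sum_subtractf)
qed

lemma sum_end_prob_le:
  assumes "is_protocol m f g a" "\<And>th s. 0 < \<pi> th s" "\<And>th. (\<Sum>s\<in>UNIV. \<pi> th s) = 1"
    "sender_strategy \<sigma>"
  shows "(\<Sum>t<n. \<Sum>i=1..m. end_prob m \<pi> th f g \<sigma> t i) \<le> 1"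
proof -
  have "(\<Sum>t<n. \<Sum>i=1..m. end_prob m \<pi> th f g \<sigma> t i)
      = 1 - (\<Sum>j=1..m. reach_prob m \<pi> th f g \<sigma> n j)"
  proof (induction n)
    case 0
    then show ?case
      using assms(1) by (simp add: is_protocol_def)
  next
    case (Suc n)
    then show ?case
      using sum_reach_prob_Suc[where \<pi>=\<pi>, OF assms(1,3), where th=th and \<sigma>=\<sigma> and t=n] by simp
  qed
  moreover have "0 \<le> (\<Sum>j=1..m. reach_prob m \<pi> th f g \<sigma> n j)"
    by (intro sum_nonneg reach_prob_nonneg[OF assms(1,2,4)])
  ultimately show ?thesis
    by linarith
qed

text \<open>The two actions share the probability of ending, which may be less than 1 because play
  can go on forever; hence an inequality in the last claim.\<close>

lemma prob_act_bounds:
  assumes prot: "is_protocol m f g a" and pos: "\<And>th s. 0 < \<pi> th s"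
    and sum1: "\<And>th. (\<Sum>s\<in>UNIV. \<pi> th s) = 1" and strat: "sender_strategy \<sigma>"
  shows prob_actH_nonneg: "0 \<le> prob_actH m \<pi> th f g a \<sigma>"
    and prob_actL_nonneg: "0 \<le> prob_actL m \<pi> th f g a \<sigma>"
    and prob_actH_actL_le: "prob_actH m \<pi> th f g a \<sigma> + prob_actL m \<pi> th f g a \<sigma> \<le> 1"
proof -
  let ?e = "end_prob m \<pi> th f g \<sigma>"
  have e0: "0 \<le> ?e t i" for t i
    by (rule end_prob_nonneg[OF prot pos strat])
  have a01: "0 \<le> a i" "a i \<le> 1" if "i \<in> {1..m}" for i
    using prot that by (auto simp: is_protocol_def)
  have sE: "summable (\<lambda>t. \<Sum>i=1..m. ?e t i)"
    by (rule summableI_nonneg_bounded[where x=1])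
       (auto intro!: sum_nonneg e0 sum_end_prob_le[OF prot pos sum1 strat, simplified])
  have H0: "0 \<le> (\<Sum>i=1..m. ?e t i * a i)" for t
    using e0 a01 by (intro sum_nonneg mult_nonneg_nonneg) auto
  have L0: "0 \<le> (\<Sum>i=1..m. ?e t i * (1 - a i))" for t
    using e0 a01 by (intro sum_nonneg mult_nonneg_nonneg) auto
  have split: "(\<Sum>i=1..m. ?e t i * a i) + (\<Sum>i=1..m. ?e t i * (1 - a i)) = (\<Sum>i=1..m. ?e t i)" for t
    by (simp add: sum.distrib[symmetric] algebra_simps)
  have sH: "summable (\<lambda>t. \<Sum>i=1..m. ?e t i * a i)"
    by (rule summable_comparison_test'[OF sE, of 0]) (use H0 L0 split in \<open>smt (verit) real_norm_def\<close>)
  have sL: "summable (\<lambda>t. \<Sum>i=1..m. ?e t i * (1 - a i))"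
    by (rule summable_comparison_test'[OF sE, of 0]) (use H0 L0 split in \<open>smt (verit) real_norm_def\<close>)
  show "0 \<le> prob_actH m \<pi> th f g a \<sigma>"
    unfolding prob_actH_def by (rule suminf_nonneg[OF sH H0])
  show "0 \<le> prob_actL m \<pi> th f g a \<sigma>"
    unfolding prob_actL_def by (rule suminf_nonneg[OF sL L0])
  have "prob_actH m \<pi> th f g a \<sigma> + prob_actL m \<pi> th f g a \<sigma> = (\<Sum>t. \<Sum>i=1..m. ?e t i)"
    unfolding prob_actH_def prob_actL_def suminf_add[OF sH sL] split ..
  also have "\<dots> \<le> 1"
    by (rule suminf_le_const[OF sE]) (rule sum_end_prob_le[OF prot pos sum1 strat])
  finally show "prob_actH m \<pi> th f g a \<sigma> + prob_actL m \<pi> th f g a \<sigma> \<le> 1" .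
qed

lemma U_R_strat_le_1:
  assumes "is_protocol m f g a" "\<And>th s. 0 < \<pi> th s" "\<And>th. (\<Sum>s\<in>UNIV. \<pi> th s) = 1"
    "sender_strategy \<sigma>" "0 < p" "p < 1"
  shows "U_R_strat m p \<pi> f g a \<sigma> \<le> 1"
proof -
  note b = prob_act_bounds[where \<pi>=\<pi>, OF assms(1-4)]
  have "p * prob_actH m \<pi> H f g a \<sigma> \<le> p * 1" "(1-p) * prob_actL m \<pi> L f g a \<sigma> \<le> (1-p) * 1"
    using b[where th=H] b[where th=L] assms(5,6) by (intro mult_left_mono; simp)+
  from add_mono[OF this] show ?thesis
    unfolding U_R_strat_def by simp
qed

text \<open>A protocol without best responses has the junk value \<open>Sup {}\<close>, which is why the maximum with it appears.\<close>

lemma U_R_le_sup_U_R: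
  assumes "\<And>th s. 0 < \<pi> th s" "\<And>th. (\<Sum>s\<in>UNIV. \<pi> th s) = 1" "0 < p" "p < 1"
    "is_protocol m f g a"
  shows "U_R m p \<pi> f g a \<le> sup_U_R m p \<pi>"
  unfolding sup_U_R_def
proof (rule cSup_upper)
  show "U_R m p \<pi> f g a \<in> {U_R m p \<pi> f g a | f g a. is_protocol m f g a}"
    using assms(5) by blast
  show "bdd_above {U_R m p \<pi> f g a | f g a. is_protocol m f g a}"
  proof (rule bdd_aboveI)
    fix u assume "u \<in> {U_R m p \<pi> f g a | f g a. is_protocol m f g a}"
    then obtain f g a where u: "u = U_R m p \<pi> f g a" and prot: "is_protocol m f g a"
      by blast
    show "u \<le> max 1 (Sup {})"
    proof (cases "br m p \<pi> f g a = {}")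
      case True
      then show ?thesis
        by (simp add: u U_R_def)
    next
      case False
      then have "u \<le> 1"
        unfolding u U_R_def
        by (rule cSUP_least)
           (use U_R_strat_le_1[OF prot assms(1,2) _ assms(3,4)] in \<open>auto simp: br_def\<close>)
      then show ?thesis
        by simp
    qed
  qed
qed

section \<open>Chains with two absorbing states\<close>

text \<open>Finiteness of the visits is left out here because it is derived in two ways: from the
  definition of transience for the given protocols, and from the upward steps for the birth-death
  walks.\<close>

locale exit_chain =
  fixes m :: nat and \<pi> :: "theta \<Rightarrow> 's::finite \<Rightarrow> real"
    and f :: "nat \<Rightarrow> 's \<Rightarrow> nat \<Rightarrow> real" and g a :: "nat \<Rightarrow> real"
  assumes m4: "4 \<le> m"
    and pi_pos: "\<And>th s. 0 < \<pi> th s"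
    and pi_sum: "\<And>th. (\<Sum>s\<in>UNIV. \<pi> th s) = 1"
    and protocol: "is_protocol m f g a"
    and abs_ends: "absorbing m f 1" "absorbing m f m"
    and nonabs: "\<And>i. i \<in> {2..m-1} \<Longrightarrow> \<not> absorbing m f i"
    and g_ends: "g 1 = 0" "g m = 0"
    and a_ends: "a 1 = 0" "a m = 1"
    and a_transient: "\<And>i. i \<in> {2..m-1} \<Longrightarrow> a i = 0"
begin

abbreviation T :: "nat set" where "T \<equiv> {2..m-1}"
abbreviation P :: "theta \<Rightarrow> nat \<Rightarrow> nat \<Rightarrow> real" where
  "P th i j \<equiv> (\<Sum>s\<in>UNIV. \<pi> th s * f i s j)"
abbreviation alive :: "theta \<Rightarrow> nat \<Rightarrow> nat \<Rightarrow> real" where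
  "alive th \<equiv> alive_prob m \<pi> th f g"
abbreviation visits :: "theta \<Rightarrow> nat \<Rightarrow> real" where
  "visits th \<equiv> exp_visits m \<pi> th f g"
abbreviation hit :: "theta \<Rightarrow> nat \<Rightarrow> real" where
  "hit th \<equiv> absorb_prob m \<pi> th f g"

lemma f_nonneg: "i \<in> {1..m} \<Longrightarrow> 0 \<le> f i s j"
  using protocol by (auto simp: is_protocol_def)

lemma f_nonneg_T: "i \<in> T \<Longrightarrow> 0 \<le> f i s j"
  by (rule f_nonneg) auto

lemma f_sum: "i \<in> T \<Longrightarrow> f i s 1 + f i s m + (\<Sum>j\<in>T. f i s j) = 1"
  using protocol sum_split_ends[of m "f i s"] m4 by (auto simp: is_protocol_def)

lemma g_nonneg: "0 \<le> g j"
  using protocol by (auto simp: is_protocol_def)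

lemma g_sum: "(\<Sum>j\<in>T. g j) = 1"
  using protocol sum_split_ends[of m g] m4 g_ends by (auto simp: is_protocol_def)

lemma P_nonneg: "i \<in> T \<Longrightarrow> 0 \<le> P th i j"
  by (auto intro!: sum_nonneg mult_nonneg_nonneg f_nonneg_T simp: pi_pos less_imp_le)

lemma P_sum: "i \<in> T \<Longrightarrow> P th i 1 + P th i m + (\<Sum>j\<in>T. P th i j) = 1"
proof -
  assume i: "i \<in> T"
  have "P th i 1 + P th i m + (\<Sum>j\<in>T. P th i j)
      = (\<Sum>s\<in>UNIV. \<pi> th s * (f i s 1 + f i s m + (\<Sum>j\<in>T. f i s j)))"
    by (subst sum.swap) (simp add: sum.distrib algebra_simps sum_distrib_left)
  then show ?thesis
    using f_sum[OF i] by (simp add: pi_sum)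
qed

lemma alive_nonneg: "0 \<le> alive th t i"
  by (induction t arbitrary: i)
     (auto intro!: sum_nonneg mult_nonneg_nonneg P_nonneg f_nonneg_T simp: g_nonneg pi_pos less_imp_le)

lemma alive_Suc: "j \<in> T \<Longrightarrow> alive th (Suc t) j = (\<Sum>i\<in>T. alive th t i * P th i j)"
  by simp

declare alive_prob.simps(2) [simp del]

lemma alive_mass_Suc:
  "(\<Sum>j\<in>T. alive th (Suc t) j) = (\<Sum>i\<in>T. alive th t i) - (\<Sum>i\<in>T. alive th t i * (P th i 1 + P th i m))"
proof -
  have "(\<Sum>j\<in>T. alive th (Suc t) j) = (\<Sum>j\<in>T. \<Sum>i\<in>T. alive th t i * P th i j)"
    by (rule sum.cong) (auto simp: alive_Suc)
  also have "\<dots> = (\<Sum>i\<in>T. alive th t i * (\<Sum>j\<in>T. P th i j))"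
    by (subst sum.swap) (simp add: sum_distrib_left)
  also have "\<dots> = (\<Sum>i\<in>T. alive th t i - alive th t i * (P th i 1 + P th i m))"
    by (rule sum.cong[OF refl], drule P_sum[of _ th])
       (simp add: algebra_simps eq_diff_eq flip: distrib_left)
  finally show ?thesis
    by (simp add: sum_subtractf)
qed

lemma exit_flow_le: "(\<Sum>t<n. \<Sum>i\<in>T. alive th t i * (P th i 1 + P th i m)) \<le> 1"
proof -
  have "(\<Sum>t<n. \<Sum>i\<in>T. alive th t i * (P th i 1 + P th i m)) = 1 - (\<Sum>i\<in>T. alive th n i)"
    by (induction n) (simp_all add: alive_mass_Suc g_sum)
  then show ?thesis
    using sum_nonneg[of T "alive th n"] alive_nonneg by simp
qed

text \<open>Each visit to \<open>i\<close> adds a fixed positive amount to the exit flow, whose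
  total is at most 1.\<close>

lemma summable_alive_of_exit:
  assumes i: "i \<in> T" and pos: "0 < P th i 1 + P th i m"
  shows "summable (\<lambda>t. alive th t i)"
proof -
  have nn: "0 \<le> alive th t j * (P th j 1 + P th j m)" if "j \<in> T" for t j
    using that by (intro mult_nonneg_nonneg add_nonneg_nonneg alive_nonneg P_nonneg)
  have "summable (\<lambda>t. \<Sum>j\<in>T. alive th t j * (P th j 1 + P th j m))"
    by (rule summableI_nonneg_bounded[where x=1]) (auto intro!: sum_nonneg nn exit_flow_le)
  then have "summable (\<lambda>t. alive th t i * (P th i 1 + P th i m))"
  proof (rule summable_comparison_test'[where N=0])
    fix t
    have "alive th t i * (P th i 1 + P th i m) \<le> (\<Sum>j\<in>T. alive th t j * (P th j 1 + P th j m))"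
      by (rule member_le_sum) (use i nn in auto)
    then show "norm (alive th t i * (P th i 1 + P th i m))
        \<le> (\<Sum>j\<in>T. alive th t j * (P th j 1 + P th j m))"
      using nn[OF i] by simp
  qed
  from summable_mult2[OF this, of "inverse (P th i 1 + P th i m)"] show ?thesis
    using pos by (simp add: mult.assoc)
qed

text \<open>Finiteness travels backwards along a transition: a fixed fraction of the visits to
  \<open>i\<close> turns into visits to \<open>j\<close> one period later.\<close>

lemma summable_alive_of_step:
  assumes i: "i \<in> T" and j: "j \<in> T" and pos: "0 < P th i j"
    and sj: "summable (\<lambda>t. alive th t j)"
  shows "summable (\<lambda>t. alive th t i)"
proof -
  have "summable (\<lambda>t. alive th (Suc t) j)"
    using sj by (subst summable_Suc_iff)
  then have "summable (\<lambda>t. alive th t i * P th i j)"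
  proof (rule summable_comparison_test'[where N=0])
    fix t
    have "alive th t i * P th i j \<le> (\<Sum>k\<in>T. alive th t k * P th k j)"
      by (rule member_le_sum) (use i in \<open>auto intro!: mult_nonneg_nonneg alive_nonneg P_nonneg\<close>)
    moreover have "0 \<le> alive th t i * P th i j"
      using i by (intro mult_nonneg_nonneg alive_nonneg P_nonneg)
    ultimately show "norm (alive th t i * P th i j) \<le> alive th (Suc t) j"
      using j by (simp add: alive_Suc)
  qed
  from summable_mult2[OF this, of "inverse (P th i j)"] show ?thesis
    using pos by (simp add: mult.assoc)
qed

text \<open>States with infinitely many expected visits only lead to states of the same kind, so one of them
  from which the fewest states can be reached is not transient.\<close>

lemma summable_alive_of_transient:
  assumes tr: "\<And>i. i \<in> T \<Longrightarrow> transient m \<pi> th f i" and i0: "i0 \<in> T"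
  shows "summable (\<lambda>t. alive th t i0)"
proof (rule ccontr)
  define B where "B = {i\<in>T. \<not> summable (\<lambda>t. alive th t i)}"
  define R where "R i = {j\<in>{1..m}. reach m \<pi> th f i j}" for i
  assume "\<not> summable (\<lambda>t. alive th t i0)"
  then have "i0 \<in> B"
    using i0 by (simp add: B_def)
  then obtain i where i: "i \<in> B" and least: "\<And>k. k \<in> B \<Longrightarrow> card (R i) \<le> card (R k)"
    using ex_has_least_nat[of "\<lambda>i. i \<in> B" i0 "\<lambda>i. card (R i)"] by blast
  have step: "z \<in> B" if y: "y \<in> B" and z: "z \<in> {1..m}" and pos: "0 < P th y z" for y z
  proof -
    have yT: "y \<in> T" and ns: "\<not> summable (\<lambda>t. alive th t y)"
      using y by (auto simp: B_def)
    have "P th y 1 + P th y m \<le> 0"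
      using summable_alive_of_exit[OF yT, of th] ns by force
    then have "P th y 1 = 0" "P th y m = 0"
      using P_nonneg[OF yT, of th 1] P_nonneg[OF yT, of th m] by linarith+
    then have "z \<noteq> 1" "z \<noteq> m"
      using pos by auto
    then have "z \<in> T"
      using z by auto
    then show ?thesis
      using summable_alive_of_step[OF yT _ pos] ns by (auto simp: B_def)
  qed
  obtain j where ij: "reach m \<pi> th f i j" and nji: "\<not> reach m \<pi> th f j i"
    using tr[of i] i by (auto simp: transient_def B_def)
  have "j \<in> B"
    using ij unfolding reach_def
    by (induction rule: rtranclp_induct) (use i step in \<open>auto simp: trans_prob_def\<close>)
  moreover have "R j \<subseteq> R i"
    using ij by (auto simp: R_def reach_def)
  moreover have "i \<in> R i" "i \<notin> R j"
    using i nji by (auto simp: R_def B_def reach_def)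
  moreover have "finite (R i)"
    by (simp add: R_def)
  ultimately have "card (R j) < card (R i)"
    by (intro psubset_card_mono) auto
  then show False
    using least[OF \<open>j \<in> B\<close>] by simp
qed

end

section \<open>Expected visits and absorption probabilities\<close>

locale transient_chain = exit_chain +
  assumes summable_alive: "\<And>th i. i \<in> {2..m-1} \<Longrightarrow> summable (\<lambda>t. alive_prob m \<pi> th f g t i)"
begin

lemma suminf_alive_mult: "i \<in> T \<Longrightarrow> (\<Sum>t. alive th t i * c) = visits th i * c"
  by (simp add: exp_visits_def suminf_mult2[OF summable_alive])

lemma summable_alive_mult: "i \<in> T \<Longrightarrow> summable (\<lambda>t. alive th t i * c)"
  by (intro summable_mult2 summable_alive)

lemma suminf_alive_flow:
  "(\<Sum>t. \<Sum>i\<in>T. alive th t i * c i) = (\<Sum>i\<in>T. visits th i * c i)"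
  by (subst suminf_sum) (auto simp: summable_alive_mult suminf_alive_mult)

lemma visits_nonneg: "i \<in> T \<Longrightarrow> 0 \<le> visits th i"
  unfolding exp_visits_def by (intro suminf_nonneg summable_alive alive_nonneg)

lemma visits_balance:
  assumes j: "j \<in> T"
  shows "visits th j = g j + (\<Sum>i\<in>T. visits th i * P th i j)"
proof -
  have "(\<Sum>t. alive th (Suc t) j) = visits th j - g j"
    using suminf_split_head[OF summable_alive[OF j, of th]] j by (simp add: exp_visits_def)
  then show ?thesis
    using j by (simp add: alive_Suc suminf_alive_flow)
qed

lemma exp_tau_eq: "exp_tau m \<pi> th f g = (\<Sum>i\<in>T. visits th i)"
  using suminf_alive_flow[of th "\<lambda>_. 1"] by (simp add: exp_tau_def)

lemma hit_eq:
  assumes "j = 1 \<or> j = m"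
  shows "hit th j = (\<Sum>i\<in>T. visits th i * P th i j)"
proof -
  have "g j = 0"
    using assms g_ends by auto
  then show ?thesis
    unfolding absorb_prob_def
    by (simp add: mult.assoc suminf_alive_flow flip: sum_distrib_left)
qed

lemma hit_nonneg: "j = 1 \<or> j = m \<Longrightarrow> 0 \<le> hit th j"
  by (auto simp: hit_eq intro!: sum_nonneg mult_nonneg_nonneg visits_nonneg P_nonneg)

text \<open>Absorption is almost sure: in the sum of all balance equations the visits, being finite,
  cancel, and the initial mass 1 is left equal to the exit flow.\<close>

lemma hit_sum: "hit th 1 + hit th m = 1"
proof -
  have "(\<Sum>j\<in>T. visits th j) = (\<Sum>j\<in>T. g j) + (\<Sum>j\<in>T. \<Sum>i\<in>T. visits th i * P th i j)"
    by (subst sum.distrib[symmetric]) (rule sum.cong[OF refl visits_balance])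
  also have "(\<Sum>j\<in>T. \<Sum>i\<in>T. visits th i * P th i j) = (\<Sum>i\<in>T. visits th i * (\<Sum>j\<in>T. P th i j))"
    by (subst sum.swap) (simp add: sum_distrib_left)
  also have "\<dots> = (\<Sum>i\<in>T. visits th i - visits th i * P th i 1 - visits th i * P th i m)"
  proof (rule sum.cong[OF refl])
    fix i assume "i \<in> T"
    then have "(\<Sum>j\<in>T. P th i j) = 1 - P th i 1 - P th i m"
      using P_sum[of i th] by simp
    then show "visits th i * (\<Sum>j\<in>T. P th i j) = visits th i - visits th i * P th i 1 - visits th i * P th i m"
      by (simp add: right_diff_distrib)
  qed
  finally show ?thesis
    by (simp add: hit_eq g_sum sum_subtractf)
qed

lemma last_step_prob_eq:
  assumes "j = 1 \<or> j = m" "i \<in> T"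
  shows "last_step_prob m \<pi> th f g i SS j = (\<Sum>s\<in>SS. visits th i * \<pi> th s * f i s j)"
proof -
  have "(\<Sum>t. \<Sum>s\<in>SS. alive th t i * \<pi> th s * f i s j) = (\<Sum>s\<in>SS. visits th i * \<pi> th s * f i s j)"
    using assms(2) by (subst suminf_sum) (auto simp: mult.assoc summable_alive_mult suminf_alive_mult)
  then show ?thesis
    using assms(1) by (auto simp: last_step_prob_def)
qed

text \<open>Optional stopping in terms of visits: weighting the balance equations by a harmonic
  \<open>w\<close> cancels all visits. This gives absorption probabilities without computing the
  visits themselves.\<close>

lemma hit_of_harmonic:
  assumes w1: "w 1 = 0"
    and harm: "\<And>i. i \<in> T \<Longrightarrow> (\<Sum>s\<in>UNIV. \<pi> th s * (\<Sum>j=1..m. f i s j * w j)) = w i"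
  shows "hit th m * w m = (\<Sum>j\<in>T. g j * w j)"
proof -
  have harm': "(\<Sum>j\<in>T. P th i j * w j) = w i - P th i m * w m" if "i \<in> T" for i
  proof -
    have "(\<Sum>s\<in>UNIV. \<pi> th s * (\<Sum>j=1..m. f i s j * w j)) = (\<Sum>j=1..m. P th i j * w j)"
      by (simp add: sum_distrib_left sum_distrib_right mult.assoc sum.swap[of _ "{1..m}"])
    also have "\<dots> = P th i m * w m + (\<Sum>j\<in>T. P th i j * w j)"
      using m4 w1 by (subst sum_split_ends) auto
    finally show ?thesis
      using harm[OF that] by linarith
  qed
  have "(\<Sum>j\<in>T. visits th j * w j) = (\<Sum>j\<in>T. g j * w j + (\<Sum>i\<in>T. visits th i * P th i j) * w j)"
    by (rule sum.cong[OF refl], subst visits_balance) (simp_all add: distrib_right)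
  also have "\<dots> = (\<Sum>j\<in>T. g j * w j) + (\<Sum>j\<in>T. \<Sum>i\<in>T. visits th i * (P th i j * w j))"
    by (simp add: sum.distrib sum_distrib_right mult.assoc)
  also have "(\<Sum>j\<in>T. \<Sum>i\<in>T. visits th i * (P th i j * w j)) = (\<Sum>i\<in>T. visits th i * (w i - P th i m * w m))"
    by (subst sum.swap) (auto simp: harm' simp flip: sum_distrib_left)
  also have "\<dots> = (\<Sum>i\<in>T. visits th i * w i) - hit th m * w m"
    by (simp add: right_diff_distrib sum_subtractf hit_eq sum_distrib_right mult.assoc)
  finally show ?thesis
    by simp
qed

lemma nonabsorbing_states: "{i\<in>{1..m}. \<not> absorbing m f i} = T"
proof (intro subset_antisym subsetI)
  fix i assume "i \<in> {i\<in>{1..m}. \<not> absorbing m f i}"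
  then have "1 \<le> i" "i \<le> m" "i \<noteq> 1" "i \<noteq> m"
    using abs_ends by auto
  then show "i \<in> T"
    by auto
qed (use nonabs in auto)

lemma reach_prob_Suc:
  "reach_prob m \<pi> th f g \<sigma> (Suc t) j = (\<Sum>i\<in>T. reach_prob m \<pi> th f g \<sigma> t i * (1 - \<sigma> i th) * P th i j)"
  using nonabsorbing_states by simp

declare reach_prob.simps(2) [simp del]

section \<open>Never stopping as a best response\<close>

abbreviation never_stop :: "nat \<Rightarrow> theta \<Rightarrow> real" where "never_stop \<equiv> \<lambda>_ _. 0"

lemma never_stop_strategy: "sender_strategy never_stop"
  by (simp add: sender_strategy_def)

lemma reach_prob_never_stop: "j \<in> T \<Longrightarrow> reach_prob m \<pi> th f g never_stop t j = alive th t j"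
proof (induction t arbitrary: j)
  case 0
  then show ?case by auto
next
  case (Suc t)
  then show ?case
    by (simp add: reach_prob_Suc alive_Suc)
qed

text \<open>Stopping only removes mass from later periods.\<close>

lemma reach_prob_le_never_stop:
  assumes "sender_strategy \<sigma>"
  shows "reach_prob m \<pi> th f g \<sigma> t j \<le> reach_prob m \<pi> th f g never_stop t j"
proof (induction t arbitrary: j)
  case (Suc t)
  have "reach_prob m \<pi> th f g \<sigma> t i * (1 - \<sigma> i th) * P th i j
      \<le> reach_prob m \<pi> th f g never_stop t i * (1 - 0) * P th i j" if "i \<in> T" for i
    using assms Suc that reach_prob_nonneg[where \<pi>=\<pi>, OF protocol pi_pos never_stop_strategy]
    by (intro mult_right_mono mult_mono P_nonneg) (auto simp: sender_strategy_def)
  then show ?case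
    unfolding reach_prob_Suc by (intro sum_mono)
qed simp

text \<open>Since \<open>a\<close> vanishes outside \<open>m\<close>, the sender gains only from
  arrivals in \<open>m\<close>, and these are most likely if play is never stopped.\<close>

lemma end_prob_actH: "(\<Sum>i=1..m. end_prob m \<pi> th f g \<sigma> t i * a i) = reach_prob m \<pi> th f g \<sigma> t m"
  using m4 abs_ends a_ends a_transient by (subst sum_split_ends) (auto simp: end_prob_def)

lemma reach_end_sums_hit:
  assumes "j = 1 \<or> j = m"
  shows "(\<lambda>t. reach_prob m \<pi> th f g never_stop t j) sums hit th j"
proof -
  have j: "j \<in> {1..m}" "g j = 0"
    using assms m4 g_ends by auto
  have "(\<lambda>t. \<Sum>i\<in>T. alive th t i * P th i j) sums (\<Sum>i\<in>T. visits th i * P th i j)"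
    using summable_sums[OF summable_sum, of T "\<lambda>i t. alive th t i * P th i j"]
    by (simp add: summable_alive_mult suminf_alive_flow)
  then have "(\<lambda>t. reach_prob m \<pi> th f g never_stop (Suc t) j) sums hit th j"
    using assms by (simp add: reach_prob_Suc reach_prob_never_stop hit_eq)
  then show ?thesis
    using j by (subst (asm) sums_Suc_iff) simp
qed

lemma prob_actH_never_stop: "prob_actH m \<pi> th f g a never_stop = hit th m"
  unfolding prob_actH_def end_prob_actH using reach_end_sums_hit[of m th] by (simp add: sums_iff)

lemma prob_actH_le_hit:
  assumes "sender_strategy \<sigma>"
  shows "prob_actH m \<pi> th f g a \<sigma> \<le> hit th m"
proof -
  have s0: "summable (\<lambda>t. reach_prob m \<pi> th f g never_stop t m)"
    using reach_end_sums_hit[of m th] by (simp add: sums_iff)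
  have "summable (\<lambda>t. reach_prob m \<pi> th f g \<sigma> t m)"
    by (rule summable_comparison_test'[OF s0, of 0])
       (use reach_prob_le_never_stop[OF assms] reach_prob_nonneg[where \<pi>=\<pi>, OF protocol pi_pos assms] in simp)
  then have "(\<Sum>t. reach_prob m \<pi> th f g \<sigma> t m) \<le> (\<Sum>t. reach_prob m \<pi> th f g never_stop t m)"
    by (intro suminf_le reach_prob_le_never_stop[OF assms] s0)
  then show ?thesis
    unfolding prob_actH_never_stop[symmetric] prob_actH_def end_prob_actH .
qed

lemma prob_actL_never_stop: "prob_actL m \<pi> th f g a never_stop = hit th 1"
proof -
  have "(\<Sum>i=1..m. end_prob m \<pi> th f g never_stop t i * (1 - a i)) = reach_prob m \<pi> th f g never_stop t 1" for t
    using m4 abs_ends a_ends nonabs by (subst sum_split_ends) (auto simp: end_prob_def)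
  then show ?thesis
    unfolding prob_actL_def using reach_end_sums_hit[of 1 th] by (simp add: sums_iff)
qed

text \<open>A best response must induce action \<open>H\<close> in either state as often as never stopping does,
  which leaves no room for it to induce action \<open>L\<close> more often.\<close>

lemma U_R_eq:
  assumes p: "0 < p" "p < 1"
  shows "U_R m p \<pi> f g a = p * hit H m + (1 - p) * hit L 1"
  unfolding U_R_def
proof (rule cSup_eq_maximum)
  have "never_stop \<in> br m p \<pi> f g a"
    using p prob_actH_le_hit
    by (auto simp: br_def never_stop_strategy U_S_def prob_actH_never_stop intro!: add_mono mult_left_mono)
  moreover have "U_R_strat m p \<pi> f g a never_stop = p * hit H m + (1 - p) * hit L 1"
    by (simp add: U_R_strat_def prob_actH_never_stop prob_actL_never_stop)
  ultimately show "p * hit H m + (1 - p) * hit L 1 \<in> U_R_strat m p \<pi> f g a ` br m p \<pi> f g a"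
    by (metis image_eqI)
next
  fix u assume "u \<in> U_R_strat m p \<pi> f g a ` br m p \<pi> f g a"
  then obtain \<sigma> where \<sigma>: "\<sigma> \<in> br m p \<pi> f g a" and u: "u = U_R_strat m p \<pi> f g a \<sigma>"
    by blast
  have strat: "sender_strategy \<sigma>"
    using \<sigma> by (simp add: br_def)
  have "U_S m p \<pi> f g a never_stop \<le> U_S m p \<pi> f g a \<sigma>"
    using \<sigma> never_stop_strategy by (simp add: br_def)
  moreover have aH: "p * prob_actH m \<pi> H f g a \<sigma> \<le> p * hit H m"
    using p prob_actH_le_hit[OF strat] by (intro mult_left_mono) auto
  ultimately have "(1 - p) * hit L m \<le> (1 - p) * prob_actH m \<pi> L f g a \<sigma>"
    unfolding U_S_def prob_actH_never_stop by linarith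
  then have "hit L m \<le> prob_actH m \<pi> L f g a \<sigma>"
    using p by simp
  then have "prob_actL m \<pi> L f g a \<sigma> \<le> hit L 1"
    using prob_actH_actL_le[where \<pi>=\<pi>, OF protocol pi_pos pi_sum strat, of L] hit_sum[of L] by linarith
  then have "(1 - p) * prob_actL m \<pi> L f g a \<sigma> \<le> (1 - p) * hit L 1"
    using p by (intro mult_left_mono) auto
  with aH show "u \<le> p * hit H m + (1 - p) * hit L 1"
    unfolding u U_R_strat_def by linarith
qed

end

section \<open>Flows of the restarted chain\<close>

lemma lratio_bounds:
  assumes "\<And>th s. 0 < \<pi> th s"
  shows lunder_le: "lunder \<pi> \<le> lratio \<pi> s" and le_lbar: "lratio \<pi> s \<le> lbar \<pi>"
    and lunder_pos: "0 < lunder \<pi>" and lbar_pos: "0 < lbar \<pi>"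
proof -
  have pos: "0 < lratio \<pi> s" for s
    using assms by (simp add: lratio_def)
  show "lunder \<pi> \<le> lratio \<pi> s" "lratio \<pi> s \<le> lbar \<pi>"
    by (simp_all add: lunder_def lbar_def)
  show "0 < lunder \<pi>"
    by (simp add: lunder_def pos)
  show "0 < lbar \<pi>"
    using pos[of s] \<open>lratio \<pi> s \<le> lbar \<pi>\<close> by simp
qed

text \<open>The order is stated for expected visits instead of \<open>nu\<close>: the expected
  durations change all ratios by one common positive factor.\<close>

locale ordered_chain = transient_chain m \<pi> f g a
  for m and \<pi> :: "theta \<Rightarrow> 's::finite \<Rightarrow> real" and f g a +
  assumes visits_pos: "\<And>th i. i \<in> {2..m-1} \<Longrightarrow> 0 < exp_visits m \<pi> th f g i"
    and ratio_mono: "\<And>i j. \<lbrakk>2 \<le> i; i \<le> j; j \<le> m - 1\<rbrakk> \<Longrightarrow>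
      exp_visits m \<pi> H f g i / exp_visits m \<pi> L f g i \<le> exp_visits m \<pi> H f g j / exp_visits m \<pi> L f g j"
begin

definition r :: "nat \<Rightarrow> real" where "r i = visits H i / visits L i"

text \<open>Absorbed paths are sent back to the initial distribution, which makes \<open>visits\<close> a stationary measure.\<close>

definition restart :: "nat \<Rightarrow> 's \<Rightarrow> nat \<Rightarrow> real" where
  "restart i s j = f i s j + (f i s 1 + f i s m) * g j"

text \<open>Expected number of periods before absorption whose state and signal form a pair in
  \<open>E\<close>, weighted by \<open>c\<close>. With a transition probability as \<open>c\<close>
  it counts moves, so exits and cut flows are treated alike.\<close>

definition mass :: "theta \<Rightarrow> (nat \<times> 's) set \<Rightarrow> (nat \<Rightarrow> 's \<Rightarrow> real) \<Rightarrow> real" where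
  "mass th E c = (\<Sum>(i, s)\<in>E. visits th i * \<pi> th s * c i s)"

definition flow :: "theta \<Rightarrow> nat set \<Rightarrow> nat set \<Rightarrow> real" where
  "flow th A B = mass th (A \<times> UNIV) (\<lambda>i s. \<Sum>j\<in>B. restart i s j)"

lemma r_pos: "i \<in> T \<Longrightarrow> 0 < r i"
  by (simp add: r_def visits_pos)

lemma r_mono: "2 \<le> i \<Longrightarrow> i \<le> j \<Longrightarrow> j \<le> m - 1 \<Longrightarrow> r i \<le> r j"
  unfolding r_def by (rule ratio_mono)

lemma restart_nonneg: "i \<in> T \<Longrightarrow> 0 \<le> restart i s j"
  unfolding restart_def by (intro add_nonneg_nonneg mult_nonneg_nonneg f_nonneg_T g_nonneg)

lemma restart_sum: "i \<in> T \<Longrightarrow> (\<Sum>j\<in>T. restart i s j) = 1"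
  using f_sum[of i s] by (simp add: restart_def sum.distrib g_sum flip: sum_distrib_left)

lemma finite_edges: "E \<subseteq> T \<times> (UNIV :: 's set) \<Longrightarrow> finite E"
  by (rule finite_subset[of _ "T \<times> UNIV"]) auto

lemma mass_times: "mass th (A \<times> S) c = (\<Sum>i\<in>A. \<Sum>s\<in>S. visits th i * \<pi> th s * c i s)"
  by (simp add: mass_def sum.cartesian_product)

lemma mass_nonneg:
  assumes "E \<subseteq> T \<times> UNIV" "\<And>i s. (i, s) \<in> E \<Longrightarrow> 0 \<le> c i s"
  shows "0 \<le> mass th E c"
  unfolding mass_def using assms
  by (auto intro!: sum_nonneg mult_nonneg_nonneg visits_nonneg simp: pi_pos less_imp_le)

lemma mass_mono:
  assumes "E \<subseteq> T \<times> UNIV" "\<And>i s. (i, s) \<in> E \<Longrightarrow> c i s \<le> d i s"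
  shows "mass th E c \<le> mass th E d"
  unfolding mass_def using assms
  by (auto intro!: sum_mono mult_left_mono mult_nonneg_nonneg visits_nonneg simp: pi_pos less_imp_le)

lemma mass_subset_split:
  "E \<subseteq> T \<times> UNIV \<Longrightarrow> B \<subseteq> E \<Longrightarrow> mass th E c = mass th B c + mass th (E - B) c"
  unfolding mass_def by (rule sum_Un_parts) (auto intro: finite_edges)

lemma mass_subset_le:
  assumes "E \<subseteq> T \<times> UNIV" "B \<subseteq> E" "\<And>i s. (i, s) \<in> E \<Longrightarrow> 0 \<le> c i s"
  shows "mass th B c \<le> mass th E c"
  using mass_subset_split[OF assms(1,2)] mass_nonneg[of "E - B" c th] assms by auto

lemma mass_mult_right: "mass th E (\<lambda>i s. c i s * x) = mass th E c * x"
  unfolding mass_def by (simp add: sum_distrib_right mult.assoc case_prod_beta)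

text \<open>Change of measure from \<open>L\<close> to \<open>H\<close>; the density of a pair does
  not depend on the weight \<open>c\<close>.\<close>

lemma mass_H:
  assumes "E \<subseteq> T \<times> UNIV"
  shows "mass H E c = (\<Sum>(i, s)\<in>E. (r i * lratio \<pi> s) * (visits L i * \<pi> L s * c i s))"
  unfolding mass_def
proof (rule sum.cong[OF refl], clarify)
  fix i s assume "(i, s) \<in> E"
  then have "visits L i \<noteq> 0"
    using visits_pos[of i L] assms by auto
  moreover have "\<pi> L s \<noteq> 0"
    using pi_pos[of L s] by simp
  ultimately show "visits H i * \<pi> H s * c i s = (r i * lratio \<pi> s) * (visits L i * \<pi> L s * c i s)"
    by (simp add: r_def lratio_def)
qed

lemma mass_H_le:
  assumes "E \<subseteq> T \<times> UNIV" "\<And>i s. (i, s) \<in> E \<Longrightarrow> 0 \<le> c i s"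
    "\<And>i s. (i, s) \<in> E \<Longrightarrow> r i * lratio \<pi> s \<le> V"
  shows "mass H E c \<le> V * mass L E c"
  unfolding mass_H[OF assms(1)] unfolding mass_def sum_distrib_left
proof (rule sum_mono, clarify)
  fix i s assume "(i, s) \<in> E"
  then show "r i * lratio \<pi> s * (visits L i * \<pi> L s * c i s) \<le> V * (visits L i * \<pi> L s * c i s)"
    using assms visits_nonneg[of i L] pi_pos[of L s] by (intro mult_right_mono mult_nonneg_nonneg) auto
qed

lemma mass_H_ge:
  assumes "E \<subseteq> T \<times> UNIV" "\<And>i s. (i, s) \<in> E \<Longrightarrow> 0 \<le> c i s"
    "\<And>i s. (i, s) \<in> E \<Longrightarrow> V \<le> r i * lratio \<pi> s"
  shows "V * mass L E c \<le> mass H E c"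
  unfolding mass_H[OF assms(1)] unfolding mass_def sum_distrib_left
proof (rule sum_mono, clarify)
  fix i s assume "(i, s) \<in> E"
  then show "V * (visits L i * \<pi> L s * c i s) \<le> r i * lratio \<pi> s * (visits L i * \<pi> L s * c i s)"
    using assms visits_nonneg[of i L] pi_pos[of L s] by (intro mult_right_mono mult_nonneg_nonneg) auto
qed

text \<open>A Markov inequality for the density: on \<open>B\<close> it is at most
  \<open>V / C\<close>, so each unit of mass there loses the fraction \<open>1 - 1 / C\<close> of
  the bound \<open>V\<close>, while \<open>tight\<close> leaves room for a total loss of order
  \<open>\<eta> - 1\<close> only.\<close>

lemma mass_concentrates_upper:
  assumes E: "E \<subseteq> T \<times> UNIV" and B: "B \<subseteq> E"
    and c: "\<And>i s. (i, s) \<in> E \<Longrightarrow> 0 \<le> c i s"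
    and le: "\<And>i s. (i, s) \<in> E \<Longrightarrow> r i * lratio \<pi> s \<le> V"
    and bad: "\<And>i s. (i, s) \<in> B \<Longrightarrow> C * (r i * lratio \<pi> s) \<le> V"
    and tight: "V * mass L E c \<le> \<eta> * mass H E c"
    and V: "0 < V" and C: "1 < C" and \<eta>: "1 \<le> \<eta>"
  shows "mass L B c \<le> (\<eta> - 1) * C / (C - 1) * mass L E c"
proof -
  let ?B = "mass L B c" and ?E = "mass L E c"
  have B0: "0 \<le> ?B"
    using E B c by (intro mass_nonneg) auto
  have "mass H B c \<le> (V / C) * ?B"
    using E B c bad C by (intro mass_H_le) (auto simp: field_simps)
  moreover have "mass H (E - B) c \<le> V * mass L (E - B) c"
    using E B c le by (intro mass_H_le) auto
  ultimately have "mass H E c \<le> V * (?E - (1 - 1 / C) * ?B)"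
    using mass_subset_split[OF E B, of L c] mass_subset_split[OF E B, of H c]
    by (simp add: algebra_simps)
  then have "\<eta> * mass H E c \<le> \<eta> * (V * (?E - (1 - 1 / C) * ?B))"
    using \<eta> by (intro mult_left_mono) auto
  with tight have "V * ?E \<le> V * (\<eta> * (?E - (1 - 1 / C) * ?B))"
    by (simp only: mult.left_commute[of \<eta> V])
  then have "?E \<le> \<eta> * (?E - (1 - 1 / C) * ?B)"
    using V by (simp only: mult_le_cancel_left_pos)
  then have "\<eta> * ((1 - 1 / C) * ?B) \<le> (\<eta> - 1) * ?E"
    by (simp add: left_diff_distrib right_diff_distrib)
  moreover have "1 * ((1 - 1 / C) * ?B) \<le> \<eta> * ((1 - 1 / C) * ?B)"
    using \<eta> B0 C by (intro mult_right_mono) auto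
  ultimately have "(1 - 1 / C) * ?B \<le> (\<eta> - 1) * ?E"
    by linarith
  then show ?thesis
    using C by (simp add: field_simps)
qed

lemma mass_concentrates_lower:
  assumes E: "E \<subseteq> T \<times> UNIV" and B: "B \<subseteq> E"
    and c: "\<And>i s. (i, s) \<in> E \<Longrightarrow> 0 \<le> c i s"
    and ge: "\<And>i s. (i, s) \<in> E \<Longrightarrow> V \<le> r i * lratio \<pi> s"
    and bad: "\<And>i s. (i, s) \<in> B \<Longrightarrow> C * V \<le> r i * lratio \<pi> s"
    and tight: "mass H E c \<le> \<eta> * (V * mass L E c)"
    and V: "0 < V" and C: "1 < C" and \<eta>: "1 \<le> \<eta>"
  shows "mass L B c \<le> (\<eta> - 1) * C / (C - 1) * mass L E c"
proof -
  let ?B = "mass L B c" and ?E = "mass L E c"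
  have E0: "0 \<le> ?E"
    using E c by (intro mass_nonneg) auto
  have "C * V * ?B \<le> mass H B c"
    using E B c bad by (intro mass_H_ge) auto
  moreover have "V * mass L (E - B) c \<le> mass H (E - B) c"
    using E B c ge by (intro mass_H_ge) auto
  ultimately have "V * (?E + (C - 1) * ?B) \<le> mass H E c"
    using mass_subset_split[OF E B, of L c] mass_subset_split[OF E B, of H c]
    by (simp add: algebra_simps)
  with tight have "V * (?E + (C - 1) * ?B) \<le> V * (\<eta> * ?E)"
    by (simp only: mult.left_commute[of \<eta> V])
  then have "?E + (C - 1) * ?B \<le> \<eta> * ?E"
    using V by (simp only: mult_le_cancel_left_pos)
  then have "(C - 1) * ?B \<le> (\<eta> - 1) * ?E"
    by (simp add: algebra_simps)
  \<comment> \<open>Giving away a factor \<open>C\<close> yields the same constant as for the upper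
    bound, so that one \<open>slack\<close> serves both.\<close>
  also have "\<dots> \<le> C * ((\<eta> - 1) * ?E)"
    using mult_right_mono[of 1 C "(\<eta> - 1) * ?E"] C \<eta> E0 by simp
  finally show ?thesis
    using C by (simp add: field_simps)
qed

section \<open>Stationarity and flow across cuts\<close>

lemma restart_set:
  "(\<Sum>j\<in>B. restart i s j) = (\<Sum>j\<in>B. f i s j) + (f i s 1 + f i s m) * (\<Sum>j\<in>B. g j)"
  by (simp add: restart_def sum.distrib flip: sum_distrib_left)

lemma flow_eq:
  "flow th A B = (\<Sum>i\<in>A. \<Sum>s\<in>UNIV. visits th i * \<pi> th s * (\<Sum>j\<in>B. restart i s j))"
  by (simp add: flow_def mass_times)

lemma flow_eq_P:
  "flow th A B = (\<Sum>i\<in>A. visits th i * (\<Sum>j\<in>B. P th i j))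
     + (\<Sum>i\<in>A. visits th i * (P th i 1 + P th i m)) * (\<Sum>j\<in>B. g j)"
proof -
  have "(\<Sum>s\<in>UNIV. visits th i * \<pi> th s * (\<Sum>j\<in>B. restart i s j))
      = visits th i * (\<Sum>j\<in>B. P th i j) + visits th i * (P th i 1 + P th i m) * (\<Sum>j\<in>B. g j)" for i
  proof -
    have "(\<Sum>s\<in>UNIV. visits th i * \<pi> th s * (\<Sum>j\<in>B. restart i s j))
      = (\<Sum>s\<in>UNIV. visits th i * (\<pi> th s * (\<Sum>j\<in>B. f i s j))
          + visits th i * (\<pi> th s * f i s 1 + \<pi> th s * f i s m) * (\<Sum>j\<in>B. g j))"
      by (simp add: restart_set algebra_simps)
    also have "\<dots> = visits th i * (\<Sum>s\<in>UNIV. \<pi> th s * (\<Sum>j\<in>B. f i s j))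
          + visits th i * (P th i 1 + P th i m) * (\<Sum>j\<in>B. g j)"
      by (simp only: sum.distrib sum_distrib_left[symmetric] sum_distrib_right[symmetric])
    also have "(\<Sum>s\<in>UNIV. \<pi> th s * (\<Sum>j\<in>B. f i s j)) = (\<Sum>j\<in>B. P th i j)"
      by (subst sum.swap) (simp add: sum_distrib_left)
    finally show ?thesis .
  qed
  then show ?thesis
    by (simp add: flow_eq sum.distrib sum_distrib_right)
qed

lemma flow_nonneg: "A \<subseteq> T \<Longrightarrow> 0 \<le> flow th A B"
  unfolding flow_def by (intro mass_nonneg sum_nonneg restart_nonneg) auto

text \<open>Restarts happen with total mass \<open>hit th 1 + hit th m = 1\<close>, so they stand in
  exactly for the initial distribution in the balance equation.\<close>

lemma flow_into:
  assumes "A \<subseteq> T"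
  shows "flow th T A = (\<Sum>j\<in>A. visits th j)"
proof -
  have "flow th T A = (\<Sum>j\<in>A. \<Sum>i\<in>T. visits th i * P th i j) + (hit th 1 + hit th m) * (\<Sum>j\<in>A. g j)"
    unfolding flow_eq_P
    by (subst sum.swap) (simp add: hit_eq distrib_left sum.distrib sum_distrib_left)
  also have "\<dots> = (\<Sum>j\<in>A. g j + (\<Sum>i\<in>T. visits th i * P th i j))"
    by (simp add: hit_sum sum.distrib)
  also have "\<dots> = (\<Sum>j\<in>A. visits th j)"
    by (rule sum.cong[OF refl], subst visits_balance) (use assms in auto)
  finally show ?thesis .
qed

lemma flow_out_of:
  assumes "A \<subseteq> T"
  shows "flow th A T = (\<Sum>i\<in>A. visits th i)"
  unfolding flow_eq
  by (rule sum.cong) (use assms in \<open>auto simp: restart_sum pi_sum simp flip: sum_distrib_left\<close>)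

text \<open>Outflow and inflow of \<open>A\<close>, moves inside \<open>A\<close> included, both
  equal the visits to \<open>A\<close>; the inner moves cancel.\<close>

lemma flow_balance:
  assumes A: "A \<subseteq> T"
  shows "flow th A (T - A) = flow th (T - A) A"
proof -
  have "flow th A T = flow th A A + flow th A (T - A)"
    unfolding flow_eq
    by (simp add: sum_Un_parts[OF _ A] distrib_left sum.distrib)
  moreover have "flow th T A = flow th A A + flow th (T - A) A"
    unfolding flow_eq by (rule sum_Un_parts[OF _ A]) simp
  ultimately show ?thesis
    using flow_into[OF A] flow_out_of[OF A] by simp
qed

lemma unvisited_of_no_inflow:
  assumes A: "A \<subseteq> T" and no: "flow th (T - A) A = 0" and gA: "(\<Sum>j\<in>A. g j) = 0"
  shows "A = {}"
proof (rule ccontr)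
  assume "A \<noteq> {}"
  then obtain k where k: "k \<in> A"
    by blast
  have finA: "finite A"
    using A finite_subset by blast
  have g0: "g j = 0" if "j \<in> A" for j
    using gA that finA by (subst (asm) sum_nonneg_eq_0_iff) (auto simp: g_nonneg)
  have P0: "P th i j = 0" if "i \<in> T - A" "j \<in> A" for i j
  proof -
    have "(\<Sum>i\<in>T-A. visits th i * (\<Sum>j\<in>A. P th i j)) = 0"
      using no gA by (simp add: flow_eq_P)
    then have "visits th i * (\<Sum>j\<in>A. P th i j) = 0"
      using that A by (subst (asm) sum_nonneg_eq_0_iff)
        (auto intro!: mult_nonneg_nonneg visits_nonneg sum_nonneg[of A] P_nonneg)
    then have "(\<Sum>j\<in>A. P th i j) = 0"
      using visits_pos[of i th] that by auto
    then show ?thesis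
      using that finA by (subst (asm) sum_nonneg_eq_0_iff) (auto intro!: P_nonneg)
  qed
  have "alive th t j = 0" if "j \<in> A" for t j
    using that
  proof (induction t arbitrary: j)
    case 0
    then show ?case by (simp add: g0)
  next
    case (Suc t)
    have "alive th t i * P th i j = 0" if "i \<in> T" for i
      using Suc P0 that by (cases "i \<in> A") auto
    then have "(\<Sum>i\<in>T. alive th t i * P th i j) = 0"
      by (intro sum.neutral ballI)
    then show ?case
      using Suc.prems A alive_Suc[of j th t] by auto
  qed
  then have "visits th k = 0"
    using k by (simp add: exp_visits_def)
  then show False
    using visits_pos[of k th] k A by auto
qed

text \<open>If nothing crossed, each side would need initial mass in order to be visited at all. An
  exit from either side would then restart on the other with positive probability, so there would be
  no exits, contradicting almost sure absorption.\<close>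

lemma cut_flow_pos:
  assumes A: "A \<subseteq> T" "A \<noteq> {}" "A \<noteq> T"
  shows "0 < flow th A (T - A)"
proof (rule ccontr)
  assume "\<not> 0 < flow th A (T - A)"
  then have U: "flow th A (T - A) = 0" and D: "flow th (T - A) A = 0"
    using flow_nonneg[OF A(1), of th "T - A"] flow_balance[OF A(1), of th] by auto
  have gA: "(\<Sum>j\<in>A. g j) \<noteq> 0"
    using unvisited_of_no_inflow[OF A(1) D] A by auto
  have TT: "T - (T - A) = A"
    using A by auto
  have gB: "(\<Sum>j\<in>T-A. g j) \<noteq> 0"
    using unvisited_of_no_inflow[of "T - A" th] U A TT by auto
  have nn: "0 \<le> (\<Sum>i\<in>X. visits th i * (\<Sum>j\<in>Y. P th i j))"
    "0 \<le> (\<Sum>i\<in>X. visits th i * (P th i 1 + P th i m))" "0 \<le> (\<Sum>j\<in>Y. g j)" if "X \<subseteq> T" for X Y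
    using that by (auto intro!: sum_nonneg mult_nonneg_nonneg add_nonneg_nonneg visits_nonneg P_nonneg g_nonneg)
  have zero: "(\<Sum>i\<in>X. visits th i * (P th i 1 + P th i m)) = 0"
    if X: "X \<subseteq> T" and fl: "flow th X Y = 0" and g: "(\<Sum>j\<in>Y. g j) \<noteq> 0" for X Y
  proof -
    have "(\<Sum>i\<in>X. visits th i * (P th i 1 + P th i m)) * (\<Sum>j\<in>Y. g j) = 0"
      using fl nn(1)[OF X, of Y] mult_nonneg_nonneg[OF nn(2)[OF X] nn(3)[OF X, of Y]]
      unfolding flow_eq_P by linarith
    then show ?thesis
      using g by simp
  qed
  have "(\<Sum>i\<in>T. visits th i * (P th i 1 + P th i m)) = 0"
    using zero[OF A(1) U gB] zero[OF _ D gA] sum_Un_parts[of T A "\<lambda>i. visits th i * (P th i 1 + P th i m)"] A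
    by simp
  then show False
    using hit_sum[of th] by (simp add: hit_eq distrib_left sum.distrib)
qed

abbreviation lo :: "nat \<Rightarrow> nat set" where "lo k \<equiv> {2..k}"
abbreviation hi :: "nat \<Rightarrow> nat set" where "hi k \<equiv> {k+1..m-1}"

lemma hi_eq: "k \<in> {2..m-2} \<Longrightarrow> hi k = T - lo k"
  by auto

lemma lo_subset: "k \<in> {2..m-2} \<Longrightarrow> lo k \<subseteq> T" and hi_subset: "k \<in> {2..m-2} \<Longrightarrow> hi k \<subseteq> T"
  by auto

lemma cut_balance: "k \<in> {2..m-2} \<Longrightarrow> flow th (lo k) (hi k) = flow th (hi k) (lo k)"
  using flow_balance[of "lo k"] hi_eq lo_subset by simp

lemma up_flow_pos: "k \<in> {2..m-2} \<Longrightarrow> 0 < flow th (lo k) (hi k)"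
proof -
  assume k: "k \<in> {2..m-2}"
  then have "lo k \<noteq> {}" "k + 1 \<in> T - lo k"
    by auto
  then show ?thesis
    using cut_flow_pos[of "lo k" th] hi_eq[OF k] lo_subset[OF k] by auto
qed

lemma up_ratio_le:
  assumes "k \<in> {2..m-2}" "i \<in> lo k"
  shows "r i * lratio \<pi> s \<le> r k * lbar \<pi>"
proof -
  have "k \<in> T" "r i \<le> r k"
    using assms by (auto intro!: r_mono)
  then show ?thesis
    using le_lbar[of \<pi> s] lunder_pos[of \<pi>] lunder_le[of \<pi> s] r_pos[of k] pi_pos
    by (intro mult_mono) auto
qed

lemma down_ratio_ge:
  assumes "k \<in> {2..m-2}" "i \<in> hi k"
  shows "r (k+1) * lunder \<pi> \<le> r i * lratio \<pi> s"
  using assms lunder_pos[of \<pi>] lunder_le[of \<pi> s] r_mono[of "k+1" i] r_pos[of "i"] pi_pos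
  by (intro mult_mono) auto

lemma up_flow_H_le:
  assumes k: "k \<in> {2..m-2}"
  shows "flow H (lo k) (hi k) \<le> r k * lbar \<pi> * flow L (lo k) (hi k)"
  unfolding flow_def
  using lo_subset[OF k] up_ratio_le[OF k]
  by (intro mass_H_le) (auto intro!: sum_nonneg restart_nonneg)

lemma down_flow_H_ge:
  assumes k: "k \<in> {2..m-2}"
  shows "r (k+1) * lunder \<pi> * flow L (hi k) (lo k) \<le> flow H (hi k) (lo k)"
  unfolding flow_def
  using hi_subset[OF k] down_ratio_ge[OF k]
  by (intro mass_H_ge) (auto intro!: sum_nonneg restart_nonneg)

lemma gamma_pos: "0 < gamma \<pi>" and lbar_eq: "lbar \<pi> = gamma \<pi> * lunder \<pi>"
  using lunder_pos[of \<pi>] lbar_pos[of \<pi>] pi_pos by (auto simp: gamma_def)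

text \<open>The flow up and the flow down agree in both states of nature. Their common quotient of
  \<open>H\<close> to \<open>L\<close> is at most \<open>r k * lbar \<pi>\<close> by the first
  description and at least \<open>r (k+1) * lunder \<pi>\<close> by the second.\<close>

lemma ratio_step:
  assumes k: "k \<in> {2..m-2}"
  shows "r (k+1) \<le> gamma \<pi> * r k"
proof -
  have "r (k+1) * lunder \<pi> * flow L (lo k) (hi k) \<le> r k * lbar \<pi> * flow L (lo k) (hi k)"
    using up_flow_H_le[OF k] down_flow_H_ge[OF k] cut_balance[OF k] by simp
  then have "r (k+1) * lunder \<pi> \<le> r k * lbar \<pi>"
    using up_flow_pos[OF k, of L] by (simp only: mult_le_cancel_right_pos)
  then have "r (k+1) * lunder \<pi> \<le> (gamma \<pi> * r k) * lunder \<pi>"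
    by (simp add: lbar_eq ac_simps)
  then show ?thesis
    using lunder_pos[of \<pi>] pi_pos by simp
qed

lemma ratio_pow:
  assumes "2 \<le> i" "i \<le> j" "j \<le> m - 1"
  shows "r j \<le> gamma \<pi> ^ (j - i) * r i"
  using assms(2,3)
proof (induction j rule: dec_induct)
  case (step n)
  have "r (n+1) \<le> gamma \<pi> * r n"
    using assms step by (intro ratio_step) auto
  also have "\<dots> \<le> gamma \<pi> * (gamma \<pi> ^ (n - i) * r i)"
    using step gamma_pos by (intro mult_left_mono) auto
  also have "\<dots> = gamma \<pi> ^ Suc (n - i) * r i"
    by simp
  also have "Suc (n - i) = Suc n - i"
    using step by simp
  finally show ?case
    by (simp only: Suc_eq_plus1)
qed simp

section \<open>The last step and the odds bound\<close>

lemma hit_eq_mass: "j = 1 \<or> j = m \<Longrightarrow> hit th j = mass th (T \<times> UNIV) (\<lambda>i s. f i s j)"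
  by (simp add: hit_eq mass_times sum_distrib_left mult.assoc)

lemma last_step_eq_mass:
  "j = 1 \<or> j = m \<Longrightarrow> i \<in> T \<Longrightarrow> last_step_prob m \<pi> th f g i S j = mass th ({i} \<times> S) (\<lambda>i s. f i s j)"
  by (simp add: last_step_prob_eq mass_times)

lemma low_ratio_ge: "i \<in> T \<Longrightarrow> r 2 * lunder \<pi> \<le> r i * lratio \<pi> s"
  using lunder_pos[of \<pi>] lunder_le[of \<pi> s] r_mono[of 2 i] r_pos[of i] pi_pos
  by (intro mult_mono) auto

lemma high_ratio_le: "i \<in> T \<Longrightarrow> r i * lratio \<pi> s \<le> r (m-1) * lbar \<pi>"
  using le_lbar[of \<pi> s] lunder_pos[of \<pi>] lunder_le[of \<pi> s] r_mono[of i "m-1"] r_pos[of "m-1"] pi_pos m4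
  by (intro mult_mono) auto

lemma hit_low_H_ge: "r 2 * lunder \<pi> * hit L 1 \<le> hit H 1"
  by (simp add: hit_eq_mass, rule mass_H_ge) (auto intro: f_nonneg_T low_ratio_ge)

lemma hit_high_H_le: "hit H m \<le> r (m-1) * lbar \<pi> * hit L m"
  by (simp add: hit_eq_mass, rule mass_H_le) (auto intro: f_nonneg_T high_ratio_le)

text \<open>The \<open>m - 3\<close> cuts give a factor \<open>gamma \<pi>\<close> each, and the
  last signals one more, as \<open>lbar \<pi> / lunder \<pi>\<close>.\<close>

lemma odds_le:
  "hit H m * hit L 1 \<le> gamma \<pi> ^ (m-2) * (hit L m * hit H 1)"
proof -
  have "hit H m * hit L 1 \<le> (r (m-1) * lbar \<pi> * hit L m) * hit L 1"
    by (intro mult_right_mono hit_high_H_le hit_nonneg) auto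
  also have "\<dots> \<le> ((gamma \<pi> ^ (m-1-2) * r 2) * lbar \<pi> * hit L m) * hit L 1"
    using m4 lbar_pos[of \<pi>] pi_pos by (intro mult_right_mono ratio_pow hit_nonneg) auto
  also have "\<dots> = gamma \<pi> ^ Suc (m-1-2) * hit L m * (r 2 * lunder \<pi> * hit L 1)"
    by (simp add: lbar_eq ac_simps)
  also have "Suc (m-1-2) = m - 2"
    using m4 by simp
  also have "gamma \<pi> ^ (m-2) * hit L m * (r 2 * lunder \<pi> * hit L 1) \<le> gamma \<pi> ^ (m-2) * hit L m * hit H 1"
    using gamma_pos by (intro mult_left_mono hit_low_H_ge mult_nonneg_nonneg hit_nonneg) auto
  finally show ?thesis
    by (simp add: mult.assoc)
qed

end

section \<open>Consequences of near-tight odds\<close>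

text \<open>\<open>\<eta>\<close> is the total defect of the odds bound and \<open>C\<close> the gap
  between extreme and other signals. By \<open>\<eta>C\<close> the ratio still grows by a factor
  \<open>C\<close> across every cut, so a wrong state costs at least as much as a wrong signal
  may.\<close>

locale tight_chain = ordered_chain m \<pi> f g a
  for m and \<pi> :: "theta \<Rightarrow> 's::finite \<Rightarrow> real" and f g a +
  fixes \<eta> C :: real
  assumes \<eta>: "1 \<le> \<eta>" and C: "1 < C" and \<eta>C: "\<eta> * C \<le> gamma \<pi>"
    and C_low: "\<And>s. s \<notin> lsig \<pi> \<Longrightarrow> C * lunder \<pi> \<le> lratio \<pi> s"
    and C_high: "\<And>s. s \<notin> hsig \<pi> \<Longrightarrow> C * lratio \<pi> s \<le> lbar \<pi>"
    and hit_L_pos: "0 < absorb_prob m \<pi> L f g m" "0 < absorb_prob m \<pi> L f g 1"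
    and tight: "gamma \<pi> ^ (m-2) * (absorb_prob m \<pi> L f g m * absorb_prob m \<pi> H f g 1)
      \<le> \<eta> * (absorb_prob m \<pi> H f g m * absorb_prob m \<pi> L f g 1)"
begin

definition slack :: real where "slack = (\<eta> - 1) * C / (C - 1)"

lemma signals_disjoint: "s \<in> lsig \<pi> \<Longrightarrow> s \<notin> hsig \<pi>"
proof
  assume "s \<in> lsig \<pi>" "s \<in> hsig \<pi>"
  then have "gamma \<pi> = 1"
    using lbar_pos[of \<pi>] pi_pos by (auto simp: lsig_def hsig_def gamma_def)
  then show False
    using \<eta>C mult_right_mono[OF \<eta>, of C] C by linarith
qed

lemmas lu_pos = lunder_pos[where \<pi>=\<pi>, OF pi_pos]
lemmas lb_pos = lbar_pos[where \<pi>=\<pi>, OF pi_pos]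
lemmas lu_le = lunder_le[where \<pi>=\<pi>, OF pi_pos]
lemmas le_lb = le_lbar[where \<pi>=\<pi>, OF pi_pos]

lemma r_ends_pos: "0 < r 2" "0 < r (m-1)"
  using m4 by (auto intro!: r_pos)

lemma ratio_le_pow: "r (m-1) * lbar \<pi> \<le> gamma \<pi> ^ (m-2) * (r 2 * lunder \<pi>)"
proof -
  have "r (m-1) * lbar \<pi> \<le> (gamma \<pi> ^ (m-1-2) * r 2) * lbar \<pi>"
    using m4 lb_pos by (intro mult_right_mono ratio_pow) auto
  also have "\<dots> = gamma \<pi> ^ Suc (m-1-2) * (r 2 * lunder \<pi>)"
    by (simp add: lbar_eq ac_simps)
  also have "Suc (m-1-2) = m - 2"
    using m4 by simp
  finally show ?thesis .
qed

text \<open>All other links of the odds bound are replaced by their unconditional estimates, which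
  leaves the whole defect \<open>\<eta>\<close> to this one. The next tightness lemmas isolate the
  other links in the same way.\<close>

lemma hit_low_tight: "hit H 1 \<le> \<eta> * (r 2 * lunder \<pi> * hit L 1)"
proof -
  have "gamma \<pi> ^ (m-2) * (hit L m * hit H 1) \<le> \<eta> * (hit H m * hit L 1)"
    by (rule tight)
  also have "\<dots> \<le> \<eta> * ((r (m-1) * lbar \<pi> * hit L m) * hit L 1)"
    using \<eta> hit_L_pos hit_high_H_le by (intro mult_left_mono mult_right_mono) auto
  also have "\<dots> \<le> \<eta> * ((gamma \<pi> ^ (m-2) * (r 2 * lunder \<pi>) * hit L m) * hit L 1)"
    using \<eta> hit_L_pos ratio_le_pow by (intro mult_left_mono mult_right_mono) auto
  finally have "(gamma \<pi> ^ (m-2) * hit L m) * hit H 1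
      \<le> (gamma \<pi> ^ (m-2) * hit L m) * (\<eta> * (r 2 * lunder \<pi> * hit L 1))"
    by (simp add: ac_simps)
  then show ?thesis
    using gamma_pos hit_L_pos by (subst (asm) mult_le_cancel_left_pos) auto
qed

lemma hit_high_tight: "r (m-1) * lbar \<pi> * hit L m \<le> \<eta> * hit H m"
proof -
  have "(r (m-1) * lbar \<pi> * hit L m) * hit L 1
      \<le> (gamma \<pi> ^ (m-2) * (r 2 * lunder \<pi>) * hit L m) * hit L 1"
    using hit_L_pos ratio_le_pow by (intro mult_right_mono) auto
  also have "\<dots> = gamma \<pi> ^ (m-2) * (hit L m * (r 2 * lunder \<pi> * hit L 1))"
    by (simp add: ac_simps)
  also have "\<dots> \<le> gamma \<pi> ^ (m-2) * (hit L m * hit H 1)"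
    using gamma_pos hit_L_pos hit_low_H_ge by (intro mult_left_mono) auto
  also have "\<dots> \<le> (\<eta> * hit H m) * hit L 1"
    using tight by (simp add: mult.assoc)
  finally show ?thesis
    using hit_L_pos by (subst (asm) mult_le_cancel_right_pos) auto
qed

lemma ratio_ends_tight: "gamma \<pi> ^ (m-3) * r 2 \<le> \<eta> * r (m-1)"
proof -
  have m3: "m - 2 = Suc (m - 3)"
    using m4 by simp
  have "gamma \<pi> ^ (m-2) * (hit L m * (r 2 * lunder \<pi> * hit L 1)) \<le> gamma \<pi> ^ (m-2) * (hit L m * hit H 1)"
    using gamma_pos hit_L_pos hit_low_H_ge by (intro mult_left_mono) auto
  also have "\<dots> \<le> \<eta> * (hit H m * hit L 1)"
    by (rule tight)
  also have "\<dots> \<le> \<eta> * ((r (m-1) * lbar \<pi> * hit L m) * hit L 1)"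
    using \<eta> hit_L_pos hit_high_H_le by (intro mult_left_mono mult_right_mono) auto
  finally have "(hit L m * hit L 1 * lunder \<pi> * gamma \<pi>) * (gamma \<pi> ^ (m-3) * r 2)
      \<le> (hit L m * hit L 1 * lunder \<pi> * gamma \<pi>) * (\<eta> * r (m-1))"
    unfolding m3 by (simp add: lbar_eq ac_simps)
  then show ?thesis
    using gamma_pos hit_L_pos lu_pos by (subst (asm) mult_le_cancel_left_pos) auto
qed

text \<open>The cuts below and above \<open>k\<close> contribute at most \<open>gamma \<pi>\<close>
  each, so this cut has to supply the rest of the growth from \<open>r 2\<close> to
  \<open>r (m-1)\<close>.\<close>

lemma ratio_step_tight:
  assumes k: "k \<in> {2..m-2}"
  shows "gamma \<pi> * r k \<le> \<eta> * r (k+1)"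
proof -
  have e: "m - 1 - (k + 1) + Suc (k - 2) = m - 3"
    using k by auto
  have "gamma \<pi> ^ (m-1-(k+1)) * (gamma \<pi> * r k)
      \<le> gamma \<pi> ^ (m-1-(k+1)) * (gamma \<pi> * (gamma \<pi> ^ (k-2) * r 2))"
    using k gamma_pos by (intro mult_left_mono ratio_pow) auto
  also have "\<dots> = gamma \<pi> ^ (m-1-(k+1) + Suc (k-2)) * r 2"
    by (simp only: power_add power_Suc mult.assoc)
  also have "\<dots> \<le> \<eta> * r (m-1)"
    unfolding e by (rule ratio_ends_tight)
  also have "\<dots> \<le> \<eta> * (gamma \<pi> ^ (m-1-(k+1)) * r (k+1))"
    using k \<eta> by (intro mult_left_mono ratio_pow) auto
  also have "\<dots> = gamma \<pi> ^ (m-1-(k+1)) * (\<eta> * r (k+1))"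
    by (simp only: mult.left_commute)
  finally show ?thesis
    using gamma_pos by (subst (asm) mult_le_cancel_left_pos) auto
qed

lemma ratio_gap:
  assumes "2 \<le> i" "i < j" "j \<le> m - 1"
  shows "C * r i \<le> r j"
proof -
  have k: "j - 1 \<in> {2..m-2}" and j: "j - 1 + 1 = j"
    using assms by auto
  have rj: "0 < r (j-1)"
    using assms by (intro r_pos) auto
  have "\<eta> * (C * r (j-1)) \<le> gamma \<pi> * r (j-1)"
    using \<eta>C rj by (simp only: mult.assoc[symmetric] mult_le_cancel_right_pos)
  also have "\<dots> \<le> \<eta> * r j"
    using ratio_step_tight[OF k] j by simp
  finally have "C * r (j-1) \<le> r j"
    using \<eta> by (subst (asm) mult_le_cancel_left_pos) auto
  moreover have "C * r i \<le> C * r (j-1)"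
    using assms C by (intro mult_left_mono r_mono) auto
  ultimately show ?thesis
    by linarith
qed

text \<open>A pair misses the extreme density by its state or by its signal, and either one costs a
  factor \<open>C\<close>.\<close>

lemma ratio_above:
  assumes "2 \<le> i" "i \<le> j" "j \<le> m - 1" "i \<noteq> j \<or> s \<notin> lsig \<pi>"
  shows "C * (r i * lunder \<pi>) \<le> r j * lratio \<pi> s"
proof (cases "i = j")
  case True
  then have "r j * (C * lunder \<pi>) \<le> r j * lratio \<pi> s"
    using assms C_low r_pos[of j] by (intro mult_left_mono) auto
  then show ?thesis
    using True by (simp add: ac_simps)
next
  case False
  have "C * r i * lunder \<pi> \<le> r j * lratio \<pi> s"
    using assms False ratio_gap[of i j] r_pos[of j] lu_pos lu_le[of s] by (intro mult_mono) auto
  then show ?thesis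
    by (simp add: ac_simps)
qed

lemma ratio_below:
  assumes "2 \<le> i" "i \<le> j" "j \<le> m - 1" "i \<noteq> j \<or> s \<notin> hsig \<pi>"
  shows "C * (r i * lratio \<pi> s) \<le> r j * lbar \<pi>"
proof (cases "i = j")
  case True
  then have "r j * (C * lratio \<pi> s) \<le> r j * lbar \<pi>"
    using assms C_high r_pos[of j] by (intro mult_left_mono) auto
  then show ?thesis
    using True by (simp add: ac_simps)
next
  case False
  have "(C * r i) * lratio \<pi> s \<le> r j * lbar \<pi>"
    using assms False ratio_gap[of i j] r_pos[of j] lu_pos lu_le[of s] le_lb[of s] by (intro mult_mono) auto
  then show ?thesis
    by (simp add: ac_simps)
qed

lemma slack_nonneg: "0 \<le> slack"
  using \<eta> C by (simp add: slack_def)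

section \<open>Concentration of the last step\<close>

lemma last_step_le_hit:
  assumes "j = 1 \<or> j = m" "i \<in> T"
  shows "last_step_prob m \<pi> th f g i S j \<le> hit th j"
  using assms(2)
  by (simp only: last_step_eq_mass[OF assms] hit_eq_mass[OF assms(1)], intro mass_subset_le)
     (auto intro: f_nonneg_T)

lemma last_step_nonneg:
  assumes "j = 1 \<or> j = m" "i \<in> T"
  shows "0 \<le> last_step_prob m \<pi> th f g i S j"
  using assms(2)
  by (simp only: last_step_eq_mass[OF assms], intro mass_nonneg) (auto intro: f_nonneg_T)

lemma low_state: "2 \<in> T" and high_state: "m - 1 \<in> T"
  using m4 by auto

lemma last_step_low_L: "(1 - slack) * hit L 1 \<le> last_step_prob m \<pi> L f g 2 (lsig \<pi>) 1"
proof -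
  let ?E = "T \<times> (UNIV :: 's set)" and ?G = "{2} \<times> lsig \<pi>"
  have "mass L (?E - ?G) (\<lambda>i s. f i s 1) \<le> slack * mass L ?E (\<lambda>i s. f i s 1)"
    unfolding slack_def
  proof (rule mass_concentrates_lower)
    show "mass H ?E (\<lambda>i s. f i s 1) \<le> \<eta> * (r 2 * lunder \<pi> * mass L ?E (\<lambda>i s. f i s 1))"
      using hit_low_tight by (simp add: hit_eq_mass)
    show "C * (r 2 * lunder \<pi>) \<le> r i * lratio \<pi> s" if "(i, s) \<in> ?E - ?G" for i s
      using that by (intro ratio_above) auto
  qed (use low_ratio_ge r_ends_pos lu_pos C \<eta> in \<open>auto intro: f_nonneg_T\<close>)
  moreover have "mass L ?E (\<lambda>i s. f i s 1) = mass L ?G (\<lambda>i s. f i s 1) + mass L (?E - ?G) (\<lambda>i s. f i s 1)"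
    using low_state by (intro mass_subset_split) auto
  ultimately show ?thesis
    using low_state by (simp add: hit_eq_mass last_step_eq_mass left_diff_distrib)
qed

text \<open>The result under \<open>H\<close> is transferred from \<open>L\<close>: on the extreme
  pair the density is exactly \<open>r 2 * lunder \<pi>\<close>. The additional
  \<open>\<eta>\<close> comes from bounding \<open>hit H 1\<close> from above by
  \<open>hit_low_tight\<close>; at the other end the upper bound \<open>hit_high_H_le\<close> holds
  without a defect.\<close>

lemma last_step_low:
  assumes "slack \<le> 1"
  shows "(1 - slack) * hit th 1 \<le> \<eta> * last_step_prob m \<pi> th f g 2 (lsig \<pi>) 1"
proof (cases th)
  case L
  have "1 * last_step_prob m \<pi> L f g 2 (lsig \<pi>) 1 \<le> \<eta> * last_step_prob m \<pi> L f g 2 (lsig \<pi>) 1"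
    using \<eta> low_state by (intro mult_right_mono last_step_nonneg) auto
  then show ?thesis
    using last_step_low_L L by simp
next
  case H
  have "(1 - slack) * hit H 1 \<le> (1 - slack) * (\<eta> * (r 2 * lunder \<pi> * hit L 1))"
    using assms hit_low_tight by (intro mult_left_mono) auto
  also have "\<dots> = \<eta> * (r 2 * lunder \<pi> * ((1 - slack) * hit L 1))"
    by (simp add: ac_simps)
  also have "\<dots> \<le> \<eta> * (r 2 * lunder \<pi> * last_step_prob m \<pi> L f g 2 (lsig \<pi>) 1)"
    using \<eta> r_ends_pos lu_pos last_step_low_L by (intro mult_left_mono) auto
  also have "\<dots> \<le> \<eta> * last_step_prob m \<pi> H f g 2 (lsig \<pi>) 1"
    using \<eta> low_state
    by (intro mult_left_mono, simp only: last_step_eq_mass refl simp_thms, intro mass_H_ge)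
       (auto intro: f_nonneg_T simp: lsig_def)
  finally show ?thesis
    using H by simp
qed

lemma last_step_high_L: "(1 - slack) * hit L m \<le> last_step_prob m \<pi> L f g (m-1) (hsig \<pi>) m"
proof -
  let ?E = "T \<times> (UNIV :: 's set)" and ?G = "{m-1} \<times> hsig \<pi>"
  have "mass L (?E - ?G) (\<lambda>i s. f i s m) \<le> slack * mass L ?E (\<lambda>i s. f i s m)"
    unfolding slack_def
  proof (rule mass_concentrates_upper)
    show "r (m-1) * lbar \<pi> * mass L ?E (\<lambda>i s. f i s m) \<le> \<eta> * mass H ?E (\<lambda>i s. f i s m)"
      using hit_high_tight by (simp add: hit_eq_mass)
    show "C * (r i * lratio \<pi> s) \<le> r (m-1) * lbar \<pi>" if "(i, s) \<in> ?E - ?G" for i s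
      using that by (intro ratio_below) auto
  qed (use high_ratio_le r_ends_pos lb_pos C \<eta> in \<open>auto intro: f_nonneg_T\<close>)
  moreover have "mass L ?E (\<lambda>i s. f i s m) = mass L ?G (\<lambda>i s. f i s m) + mass L (?E - ?G) (\<lambda>i s. f i s m)"
    using high_state by (intro mass_subset_split) auto
  ultimately show ?thesis
    using high_state by (simp add: hit_eq_mass last_step_eq_mass left_diff_distrib)
qed

lemma last_step_high:
  assumes "slack \<le> 1"
  shows "(1 - slack) * hit th m \<le> last_step_prob m \<pi> th f g (m-1) (hsig \<pi>) m"
proof (cases th)
  case L
  then show ?thesis
    using last_step_high_L by simp
next
  case H
  have "(1 - slack) * hit H m \<le> (1 - slack) * (r (m-1) * lbar \<pi> * hit L m)"
    using assms hit_high_H_le by (intro mult_left_mono) auto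
  also have "\<dots> = r (m-1) * lbar \<pi> * ((1 - slack) * hit L m)"
    by (simp add: ac_simps)
  also have "\<dots> \<le> r (m-1) * lbar \<pi> * last_step_prob m \<pi> L f g (m-1) (hsig \<pi>) m"
    using r_ends_pos lb_pos last_step_high_L by (intro mult_left_mono) auto
  also have "\<dots> \<le> last_step_prob m \<pi> H f g (m-1) (hsig \<pi>) m"
    using high_state
    by (simp only: last_step_eq_mass refl simp_thms, intro mass_H_ge)
       (auto intro: f_nonneg_T simp: hsig_def)
  finally show ?thesis
    using H by simp
qed

section \<open>Concentration of cut flows and growth of the visits\<close>

lemma up_flow_concentrates:
  assumes k: "k \<in> {2..m-2}"
  shows "mass L (lo k \<times> UNIV - {k} \<times> hsig \<pi>) (\<lambda>i s. \<Sum>j\<in>hi k. restart i s j) \<le> slack * flow L (lo k) (hi k)"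
  unfolding slack_def flow_def
proof (rule mass_concentrates_upper)
  \<comment> \<open>The lower bound for the upward flow under \<open>H\<close> is obtained from the
    downward flow, to which it is equal by balance.\<close>
  have "gamma \<pi> * r k * lunder \<pi> * flow L (lo k) (hi k) \<le> \<eta> * r (k+1) * lunder \<pi> * flow L (lo k) (hi k)"
    using ratio_step_tight[OF k] lu_pos up_flow_pos[OF k, of L] by (intro mult_right_mono) auto
  also have "\<dots> = \<eta> * (r (k+1) * lunder \<pi> * flow L (hi k) (lo k))"
    by (simp add: cut_balance[OF k])
  also have "\<dots> \<le> \<eta> * flow H (hi k) (lo k)"
    using \<eta> down_flow_H_ge[OF k] by (intro mult_left_mono) auto
  also have "\<dots> = \<eta> * flow H (lo k) (hi k)"
    by (simp only: cut_balance[OF k])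
  finally show "r k * lbar \<pi> * mass L (lo k \<times> UNIV) (\<lambda>i s. \<Sum>j\<in>hi k. restart i s j)
      \<le> \<eta> * mass H (lo k \<times> UNIV) (\<lambda>i s. \<Sum>j\<in>hi k. restart i s j)"
    unfolding flow_def by (simp add: lbar_eq ac_simps)
  show "C * (r i * lratio \<pi> s) \<le> r k * lbar \<pi>" if "(i, s) \<in> lo k \<times> UNIV - {k} \<times> hsig \<pi>" for i s
    using that k by (intro ratio_below) auto
  show "0 < r k * lbar \<pi>"
    using k lb_pos by (intro mult_pos_pos r_pos) auto
qed (use k C \<eta> up_ratio_le[OF k] in \<open>auto intro!: sum_nonneg restart_nonneg\<close>)

lemma down_flow_concentrates:
  assumes k: "k \<in> {2..m-2}"
  shows "mass L (hi k \<times> UNIV - {k+1} \<times> lsig \<pi>) (\<lambda>i s. \<Sum>j\<in>lo k. restart i s j) \<le> slack * flow L (hi k) (lo k)"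
  unfolding slack_def flow_def
proof (rule mass_concentrates_lower)
  have "flow H (hi k) (lo k) \<le> r k * lbar \<pi> * flow L (lo k) (hi k)"
    using up_flow_H_le[OF k] cut_balance[OF k, of H] by simp
  also have "\<dots> = gamma \<pi> * r k * lunder \<pi> * flow L (lo k) (hi k)"
    by (simp add: lbar_eq)
  also have "\<dots> \<le> \<eta> * r (k+1) * lunder \<pi> * flow L (lo k) (hi k)"
    using ratio_step_tight[OF k] lu_pos up_flow_pos[OF k, of L] by (intro mult_right_mono) auto
  also have "\<dots> = \<eta> * (r (k+1) * lunder \<pi> * flow L (hi k) (lo k))"
    by (simp add: cut_balance[OF k])
  finally show "mass H (hi k \<times> UNIV) (\<lambda>i s. \<Sum>j\<in>lo k. restart i s j)
      \<le> \<eta> * (r (k+1) * lunder \<pi> * mass L (hi k \<times> UNIV) (\<lambda>i s. \<Sum>j\<in>lo k. restart i s j))"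
    unfolding flow_def .
  show "C * (r (k+1) * lunder \<pi>) \<le> r i * lratio \<pi> s" if "(i, s) \<in> hi k \<times> UNIV - {k+1} \<times> lsig \<pi>" for i s
    using that k by (intro ratio_above) auto
  show "0 < r (k+1) * lunder \<pi>"
    using k lu_pos by (intro mult_pos_pos r_pos) auto
qed (use k C \<eta> down_ratio_ge[OF k] in \<open>auto intro!: sum_nonneg restart_nonneg\<close>)

lemma restart_set_ge:
  assumes "i \<in> T"
  shows "f i s 1 * (\<Sum>j\<in>B. g j) \<le> (\<Sum>j\<in>B. restart i s j)" "f i s m * (\<Sum>j\<in>B. g j) \<le> (\<Sum>j\<in>B. restart i s j)"
proof -
  have "0 \<le> (\<Sum>j\<in>B. f i s j)" "0 \<le> f i s 1 * (\<Sum>j\<in>B. g j)" "0 \<le> f i s m * (\<Sum>j\<in>B. g j)"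
    using assms by (auto intro!: sum_nonneg mult_nonneg_nonneg f_nonneg_T g_nonneg)
  then show "f i s 1 * (\<Sum>j\<in>B. g j) \<le> (\<Sum>j\<in>B. restart i s j)" "f i s m * (\<Sum>j\<in>B. g j) \<le> (\<Sum>j\<in>B. restart i s j)"
    by (simp_all add: restart_set distrib_right)
qed

lemma g_sum_nonneg: "0 \<le> (\<Sum>j\<in>B. g j)"
  by (intro sum_nonneg g_nonneg)

text \<open>Absorption in state 1 comes from the pair \<open>(2, l)\<close>, so its restarts above the cut belong to the
  negligible part of the upward flow; likewise for state \<open>m\<close> and the downward flow.\<close>

lemma restart_above_le:
  assumes k: "k \<in> {2..m-2}"
  shows "(1 - slack) * hit L 1 * (\<Sum>j\<in>hi k. g j) \<le> slack * flow L (lo k) (hi k)"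
proof -
  have "(1 - slack) * hit L 1 * (\<Sum>j\<in>hi k. g j) \<le> mass L ({2} \<times> lsig \<pi>) (\<lambda>i s. f i s 1) * (\<Sum>j\<in>hi k. g j)"
    using last_step_low_L low_state
    by (intro mult_right_mono g_sum_nonneg) (simp add: last_step_eq_mass)
  also have "\<dots> = mass L ({2} \<times> lsig \<pi>) (\<lambda>i s. f i s 1 * (\<Sum>j\<in>hi k. g j))"
    by (simp add: mass_mult_right)
  also have "\<dots> \<le> mass L ({2} \<times> lsig \<pi>) (\<lambda>i s. \<Sum>j\<in>hi k. restart i s j)"
    using low_state by (intro mass_mono restart_set_ge) auto
  also have "\<dots> \<le> mass L (lo k \<times> UNIV - {k} \<times> hsig \<pi>) (\<lambda>i s. \<Sum>j\<in>hi k. restart i s j)"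
    using k signals_disjoint by (intro mass_subset_le) (auto intro!: sum_nonneg restart_nonneg)
  finally show ?thesis
    using up_flow_concentrates[OF k] by linarith
qed

lemma restart_below_le:
  assumes k: "k \<in> {2..m-2}"
  shows "(1 - slack) * hit L m * (\<Sum>j\<in>lo k. g j) \<le> slack * flow L (lo k) (hi k)"
proof -
  have "(1 - slack) * hit L m * (\<Sum>j\<in>lo k. g j) \<le> mass L ({m-1} \<times> hsig \<pi>) (\<lambda>i s. f i s m) * (\<Sum>j\<in>lo k. g j)"
    using last_step_high_L high_state
    by (intro mult_right_mono g_sum_nonneg) (simp add: last_step_eq_mass)
  also have "\<dots> = mass L ({m-1} \<times> hsig \<pi>) (\<lambda>i s. f i s m * (\<Sum>j\<in>lo k. g j))"
    by (simp add: mass_mult_right)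
  also have "\<dots> \<le> mass L ({m-1} \<times> hsig \<pi>) (\<lambda>i s. \<Sum>j\<in>lo k. restart i s j)"
    using high_state by (intro mass_mono restart_set_ge) auto
  also have "\<dots> \<le> mass L (hi k \<times> UNIV - {k+1} \<times> lsig \<pi>) (\<lambda>i s. \<Sum>j\<in>lo k. restart i s j)"
    using k signals_disjoint by (intro mass_subset_le) (auto intro!: sum_nonneg restart_nonneg)
  finally show ?thesis
    using down_flow_concentrates[OF k] unfolding cut_balance[OF k, symmetric] by linarith
qed

text \<open>The initial mass below and above the cut adds up to 1, so the two restart bounds, each
  carrying one of these masses, cannot both be trivial.\<close>

lemma cut_flow_large:
  assumes k: "k \<in> {2..m-2}" and slack1: "slack \<le> 1" and b: "b \<le> hit L 1" "b \<le> hit L m"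
  shows "(1 - slack) * b \<le> 2 * slack * flow L (lo k) (hi k)"
proof -
  have "(\<Sum>j\<in>lo k. g j) + (\<Sum>j\<in>hi k. g j) = 1"
    using sum_Un_parts[of T "lo k" g] lo_subset[OF k] hi_eq[OF k] g_sum by simp
  then have "(1 - slack) * b = (1 - slack) * b * ((\<Sum>j\<in>lo k. g j) + (\<Sum>j\<in>hi k. g j))"
    by simp
  also have "\<dots> \<le> (1 - slack) * hit L m * (\<Sum>j\<in>lo k. g j) + (1 - slack) * hit L 1 * (\<Sum>j\<in>hi k. g j)"
    using b slack1 unfolding distrib_left
    by (intro add_mono mult_right_mono mult_left_mono g_sum_nonneg) auto
  finally show ?thesis
    using restart_above_le[OF k] restart_below_le[OF k] by linarith
qed

lemma mass_le_visits:
  assumes i: "i \<in> T" and c: "\<And>s. 0 \<le> c i s" "\<And>s. c i s \<le> 1"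
  shows "mass th ({i} \<times> S) c \<le> visits th i"
proof -
  have "mass th ({i} \<times> S) c \<le> mass th ({i} \<times> UNIV) c"
    using i c by (intro mass_subset_le) auto
  also have "\<dots> \<le> mass th ({i} \<times> UNIV) (\<lambda>i s. 1)"
    using i c by (intro mass_mono) auto
  also have "\<dots> = visits th i"
    by (simp add: mass_times pi_sum flip: sum_distrib_left)
  finally show ?thesis .
qed

lemma restart_set_le_1: "i \<in> T \<Longrightarrow> B \<subseteq> T \<Longrightarrow> (\<Sum>j\<in>B. restart i s j) \<le> 1"
  using sum_mono2[of T B "restart i s"] restart_nonneg restart_sum[of i s] by auto

text \<open>Up to \<open>slack\<close>, the upward flow starts in the single state \<open>k\<close>
  and the downward flow in \<open>k+1\<close>, and a visit accounts for at most one
  crossing.\<close>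

lemma flow_le_visits:
  assumes k: "k \<in> {2..m-2}"
  shows "(1 - slack) * flow L (lo k) (hi k) \<le> visits L k" "(1 - slack) * flow L (lo k) (hi k) \<le> visits L (k+1)"
proof -
  have T: "k \<in> T" "k + 1 \<in> T"
    using k by auto
  have "flow L (lo k) (hi k) = mass L ({k} \<times> hsig \<pi>) (\<lambda>i s. \<Sum>j\<in>hi k. restart i s j)
      + mass L (lo k \<times> UNIV - {k} \<times> hsig \<pi>) (\<lambda>i s. \<Sum>j\<in>hi k. restart i s j)"
    unfolding flow_def using k by (intro mass_subset_split) auto
  moreover have "mass L ({k} \<times> hsig \<pi>) (\<lambda>i s. \<Sum>j\<in>hi k. restart i s j) \<le> visits L k"
    using T hi_subset[OF k] by (intro mass_le_visits sum_nonneg restart_nonneg restart_set_le_1)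
  ultimately show "(1 - slack) * flow L (lo k) (hi k) \<le> visits L k"
    using up_flow_concentrates[OF k] by (simp add: left_diff_distrib)
  have "flow L (hi k) (lo k) = mass L ({k+1} \<times> lsig \<pi>) (\<lambda>i s. \<Sum>j\<in>lo k. restart i s j)
      + mass L (hi k \<times> UNIV - {k+1} \<times> lsig \<pi>) (\<lambda>i s. \<Sum>j\<in>lo k. restart i s j)"
    unfolding flow_def using k by (intro mass_subset_split) auto
  moreover have "mass L ({k+1} \<times> lsig \<pi>) (\<lambda>i s. \<Sum>j\<in>lo k. restart i s j) \<le> visits L (k+1)"
    using T lo_subset[OF k] by (intro mass_le_visits sum_nonneg restart_nonneg restart_set_le_1)
  ultimately show "(1 - slack) * flow L (lo k) (hi k) \<le> visits L (k+1)"
    using down_flow_concentrates[OF k] cut_balance[OF k, of L] by (simp add: left_diff_distrib)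
qed

text \<open>Every transient state borders a cut: the top state lies just above the last one, any
  other \<open>i\<close> just below the cut at \<open>i\<close>.\<close>

lemma visits_large:
  assumes i: "i \<in> T" and slack1: "slack \<le> 1" and b: "b \<le> hit L 1" "b \<le> hit L m"
  shows "(1 - slack)\<^sup>2 * b \<le> 2 * slack * visits L i"
proof -
  obtain k where k: "k \<in> {2..m-2}" and v: "(1 - slack) * flow L (lo k) (hi k) \<le> visits L i"
  proof (cases "i = m - 1")
    case True
    then have "m - 2 \<in> {2..m-2}" "i = m - 2 + 1"
      using m4 by auto
    then show ?thesis
      using that flow_le_visits(2)[of "m - 2"] by metis
  next
    case False
    then have "i \<in> {2..m-2}"
      using i by auto
    then show ?thesis
      using that flow_le_visits(1) by blast
  qed
  have "(1 - slack)\<^sup>2 * b = (1 - slack) * ((1 - slack) * b)"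
    by (simp add: power2_eq_square)
  also have "\<dots> \<le> (1 - slack) * (2 * slack * flow L (lo k) (hi k))"
    using slack1 cut_flow_large[OF k slack1 b] by (intro mult_left_mono) auto
  also have "\<dots> = 2 * slack * ((1 - slack) * flow L (lo k) (hi k))"
    by simp
  also have "\<dots> \<le> 2 * slack * visits L i"
    using slack_nonneg v by (intro mult_left_mono) auto
  finally show ?thesis .
qed

text \<open>The expected number of exits is 1 in total, so many visits to \<open>i\<close> force a
  small exit probability per visit, with \<open>\<pi> L s\<close> as the cost of fixing the
  signal.\<close>

lemma exit_prob_le:
  assumes i: "i \<in> T" and slack1: "slack \<le> 1" and b: "b \<le> hit L 1" "b \<le> hit L m"
  shows "(f i s 1 + f i s m) * ((1 - slack)\<^sup>2 * b * \<pi> L s) \<le> 2 * slack"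
proof -
  have "last_step_prob m \<pi> L f g i {s} 1 + last_step_prob m \<pi> L f g i {s} m \<le> 1"
    using last_step_le_hit[of 1 i L "{s}"] last_step_le_hit[of m i L "{s}"] i hit_sum[of L] by linarith
  then have exit: "visits L i * (\<pi> L s * (f i s 1 + f i s m)) \<le> 1"
    using i by (simp add: last_step_prob_eq distrib_left mult.assoc)
  have "(f i s 1 + f i s m) * ((1 - slack)\<^sup>2 * b * \<pi> L s) = ((1 - slack)\<^sup>2 * b) * (\<pi> L s * (f i s 1 + f i s m))"
    by (simp add: ac_simps)
  also have "\<dots> \<le> (2 * slack * visits L i) * (\<pi> L s * (f i s 1 + f i s m))"
    using visits_large[OF assms] f_nonneg_T[OF i] pi_pos[of L s]
    by (intro mult_right_mono mult_nonneg_nonneg add_nonneg_nonneg) auto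
  also have "\<dots> = 2 * slack * (visits L i * (\<pi> L s * (f i s 1 + f i s m)))"
    by (simp add: mult.assoc)
  also have "\<dots> \<le> 2 * slack * 1"
    using slack_nonneg exit by (intro mult_left_mono) auto
  finally show ?thesis
    by simp
qed

end

section \<open>Birth-death walks\<close>

text \<open>\<open>\<delta>\<close> makes exits rare at both ends, and \<open>\<omega>\<close>, the
  quotient of the two exit rates, steers how the error is divided between the states of
  nature.\<close>

locale birth_death =
  fixes m :: nat and \<pi> :: "theta \<Rightarrow> 's::finite \<Rightarrow> real" and h l :: 's and \<delta> \<omega> :: real
  assumes m4: "4 \<le> m"
    and pi_pos: "\<And>th s. 0 < \<pi> th s"
    and pi_sum: "\<And>th. (\<Sum>s\<in>UNIV. \<pi> th s) = 1"
    and hl: "h \<noteq> l"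
    and \<delta>: "0 < \<delta>" "\<delta> \<le> 1" and \<omega>: "0 < \<omega>" and \<delta>\<omega>: "\<delta> * \<omega> \<le> 1"
begin

definition up :: "nat \<Rightarrow> real" where "up i = (if i = m - 1 then \<delta> * \<omega> else 1)"
definition down :: "nat \<Rightarrow> real" where "down i = (if i = 2 then \<delta> else 1)"

definition walk :: "nat \<Rightarrow> 's \<Rightarrow> nat \<Rightarrow> real" where
  "walk i s j =
    (if i \<in> {2..m-1} \<and> s = h then (if j = i + 1 then up i else 0) + (if j = i then 1 - up i else 0)
     else if i \<in> {2..m-1} \<and> s = l then (if j = i - 1 then down i else 0) + (if j = i then 1 - down i else 0)
     else (if j = i then 1 else 0))"

definition start :: "nat \<Rightarrow> real" where "start j = (if j = 2 then 1 else 0)"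
definition act :: "nat \<Rightarrow> real" where "act j = (if j = m then 1 else 0)"

lemma up_bounds: "0 < up i" "up i \<le> 1" and down_bounds: "0 < down i" "down i \<le> 1"
  using \<delta> \<omega> \<delta>\<omega> by (auto simp: up_def down_def)

lemma sum_walk:
  assumes i: "i \<in> {2..m-1}"
  shows "(\<Sum>j=1..m. walk i s j * w j) = w i + (if s = h then up i * (w (i+1) - w i)
    else if s = l then down i * (w (i-1) - w i) else 0)"
proof -
  have delta: "(\<Sum>j=1..m. (if j = k then c else 0) * w j) = c * w k" if "k \<in> {1..m}" for k c
    using that by (subst sum.remove[of _ k]) auto
  have "i \<in> {1..m}" "i + 1 \<in> {1..m}" "i - 1 \<in> {1..m}"
    using i by auto
  note d = this[THEN delta]
  show ?thesis
    using i hl unfolding walk_def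
    by (simp add: distrib_right sum.distrib d[simplified]) (simp add: algebra_simps)
qed

lemma sum_walk_absorbed:
  assumes "i \<in> {1..m}" "i \<notin> {2..m-1}"
  shows "(\<Sum>j=1..m. walk i s j) = 1"
proof -
  have "(\<Sum>j=1..m. walk i s j) = (\<Sum>j\<in>{1..m}. if j = i then 1 else 0)"
    using assms(2) by (intro sum.cong) (auto simp: walk_def)
  then show ?thesis
    using assms(1) by (simp only: sum.delta finite_atLeastAtMost if_True)
qed

lemma walk_protocol: "is_protocol m walk start act"
  unfolding is_protocol_def
proof (intro conjI ballI allI impI)
  fix i s assume i: "i \<in> {1..m}"
  show "0 \<le> walk i s j" for j
    using up_bounds[of i] down_bounds[of i] by (auto simp: walk_def)
  show "walk i s j = 0" if "j \<notin> {1..m}" for j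
    using that i by (auto simp: walk_def)
  show "(\<Sum>j=1..m. walk i s j) = 1"
    using sum_walk[of i s "\<lambda>_. 1"] sum_walk_absorbed[OF i] by (cases "i \<in> {2..m-1}") auto
qed (use m4 in \<open>auto simp: start_def act_def\<close>)

sublocale exit_chain m \<pi> walk start act
proof
  show "absorbing m walk 1" "absorbing m walk m"
    using m4 by (auto simp: absorbing_def walk_def)
  show "\<not> absorbing m walk i" if "i \<in> {2..m-1}" for i
    using that up_bounds[of i] by (auto simp: absorbing_def walk_def intro!: exI[of _ h])
qed (use m4 pi_pos pi_sum walk_protocol in \<open>auto simp: start_def act_def\<close>)

lemma P_up_pos:
  assumes "i \<in> T"
  shows "0 < P th i (i+1)"
proof -
  have "\<pi> th h * walk i h (i+1) \<le> P th i (i+1)"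
    using assms by (intro member_le_sum mult_nonneg_nonneg f_nonneg_T) (auto simp: pi_pos less_imp_le)
  moreover have "0 < \<pi> th h * walk i h (i+1)"
    using assms up_bounds[of i] pi_pos[of th h] by (simp add: walk_def)
  ultimately show ?thesis
    by linarith
qed

sublocale transient_chain m \<pi> walk start act
proof
  fix th i assume "i \<in> T"
  then have "i \<le> m - 1" "2 \<le> i"
    by auto
  then show "summable (\<lambda>t. alive th t i)"
  proof (induction rule: inc_induct)
    case base
    have "0 < P th (m-1) 1 + P th (m-1) m"
      using P_up_pos[of "m-1" th] P_nonneg[of "m-1" th 1] m4 by (simp add: add_nonneg_pos)
    then show ?case
      using m4 by (intro summable_alive_of_exit) auto
  next
    case (step n)
    then show ?case
      using P_up_pos[of n th] unfolding Suc_eq_plus1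
      by (intro summable_alive_of_step[of n "n+1"]) auto
  qed
qed

text \<open>Up to scaling, the probability of hitting \<open>m\<close>: on state \<open>i\<close> the upward step has to balance the
  downward one, so the increments form a geometric sequence, distorted by the exit rates at both ends.\<close>

definition ladder :: "real \<Rightarrow> nat \<Rightarrow> real" where
  "ladder \<rho> j = (if j = 1 then 0
     else 1 + \<delta> * (\<Sum>k\<in>{2..<min j (m-1)}. \<rho> ^ (k-1)) + (if j = m then \<rho> ^ (m-2) / \<omega> else 0))"

text \<open>The cap at \<open>m-1\<close> stops the geometric sum before the top step. Its increment
  is \<open>\<rho> ^ (m-2) / \<omega>\<close> instead, so that the exit rate
  \<open>\<delta> * \<omega>\<close> restores the common pattern.\<close>

lemma ladder_up:
  assumes "i \<in> T"
  shows "up i * (ladder \<rho> (i+1) - ladder \<rho> i) = \<delta> * \<rho> ^ (i-1)"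
proof (cases "i = m - 1")
  case True
  then have "i - 1 = m - 2" "i + 1 = m" "i \<noteq> m" "i \<noteq> 1" "min m (m - 1) = m - 1"
    using m4 by auto
  then show ?thesis
    using True \<omega> m4 by (simp add: up_def ladder_def)
next
  case False
  then have "min i (m-1) = i" "min (i+1) (m-1) = Suc i" "2 \<le> i" "i \<noteq> m" "i + 1 \<noteq> m"
    using assms by auto
  then show ?thesis
    using False by (simp add: up_def ladder_def distrib_left)
qed

lemma ladder_down:
  assumes "i \<in> T"
  shows "down i * (ladder \<rho> i - ladder \<rho> (i-1)) = \<delta> * \<rho> ^ (i-2)"
proof (cases "i = 2")
  case True
  then show ?thesis
    using m4 by (simp add: down_def ladder_def)
next
  case False
  then obtain k where k: "i = Suc k" "2 \<le> k"
    using assms by (cases i) auto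
  then have "min k (m-1) = k" "min (Suc k) (m-1) = Suc k" "Suc k \<noteq> m" "k \<noteq> m" "Suc k - 2 = k - 1"
    using assms by auto
  then show ?thesis
    using k False by (simp add: down_def ladder_def distrib_left)
qed

lemma hit_eq_ladder:
  "hit th m = 1 / (1 + \<delta> * (\<Sum>k\<in>{2..<m-1}. (\<pi> th l / \<pi> th h) ^ (k-1)) + (\<pi> th l / \<pi> th h) ^ (m-2) / \<omega>)"
proof -
  define \<rho> where "\<rho> = \<pi> th l / \<pi> th h"
  let ?w = "ladder \<rho>"
  have \<rho>: "0 < \<rho>" "\<rho> * \<pi> th h = \<pi> th l"
    using pi_pos[of th h] pi_pos[of th l] by (auto simp: \<rho>_def)
  have "hit th m * ?w m = (\<Sum>j\<in>T. start j * ?w j)"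
  proof (rule hit_of_harmonic)
    show "?w 1 = 0"
      by (simp add: ladder_def)
    fix i assume i: "i \<in> T"
    then have i2: "i - 1 = Suc (i - 2)"
      by auto
    have balance: "\<pi> th h * (\<delta> * \<rho> ^ (i-1)) = \<pi> th l * (\<delta> * \<rho> ^ (i-2))"
      unfolding i2 by (simp flip: \<rho>(2))
    have "(\<Sum>s\<in>UNIV. \<pi> th s * (\<Sum>j=1..m. walk i s j * ?w j))
      = (\<Sum>s\<in>UNIV. \<pi> th s * ?w i + (if s = h then \<pi> th s * (up i * (?w (i+1) - ?w i)) else 0)
          + (if s = l then \<pi> th s * (down i * (?w (i-1) - ?w i)) else 0))"
      using hl by (intro sum.cong refl) (simp add: sum_walk[OF i] distrib_left)
    also have "\<dots> = (\<Sum>s\<in>UNIV. \<pi> th s * ?w i) + \<pi> th h * (up i * (?w (i+1) - ?w i))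
        + \<pi> th l * (down i * (?w (i-1) - ?w i))"
      by (simp add: sum.distrib)
    also have "down i * (?w (i-1) - ?w i) = - (down i * (?w i - ?w (i-1)))"
      by (simp add: algebra_simps)
    also have "(\<Sum>s\<in>UNIV. \<pi> th s * ?w i) = ?w i"
      by (simp add: pi_sum flip: sum_distrib_right)
    also have "?w i + \<pi> th h * (up i * (?w (i+1) - ?w i)) + \<pi> th l * (- (down i * (?w i - ?w (i-1)))) = ?w i"
      unfolding ladder_up[OF i] ladder_down[OF i] using balance by simp
    finally show "(\<Sum>s\<in>UNIV. \<pi> th s * (\<Sum>j=1..m. walk i s j * ?w j)) = ?w i" .
  qed
  \<comment> \<open>The walk starts in 2, where the ladder is normalized to 1; the hitting
    probability is therefore the reciprocal of its top value.\<close>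
  also have "\<dots> = ?w 2"
    using m4 by (subst sum.remove[of _ 2]) (auto simp: start_def)
  also have "\<dots> = 1"
    using m4 by (simp add: ladder_def)
  finally have "hit th m * ?w m = 1" .
  moreover have "?w m = 1 + \<delta> * (\<Sum>k\<in>{2..<m-1}. \<rho> ^ (k-1)) + \<rho> ^ (m-2) / \<omega>"
    using m4 by (simp add: ladder_def)
  moreover have "0 \<le> \<delta> * (\<Sum>k\<in>{2..<m-1}. \<rho> ^ (k-1))" "0 < \<rho> ^ (m-2) / \<omega>"
    using \<rho> \<delta> \<omega> by (auto intro!: mult_nonneg_nonneg sum_nonneg)
  ultimately show ?thesis
    unfolding \<rho>_def[symmetric] by (simp add: eq_divide_eq)
qed

end

section \<open>Lower bound for the supremum\<close>

lemma sup_U_R_ge: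
  fixes \<pi> :: "theta \<Rightarrow> 's::finite \<Rightarrow> real"
  assumes m4: "4 \<le> m" and pos: "\<And>th s. 0 < \<pi> th s" and sum1: "\<And>th. (\<Sum>s\<in>UNIV. \<pi> th s) = 1"
    and gam: "1 < gamma \<pi>" and p: "0 < p" "p < 1" and x: "0 < x"
  shows "p * (1 / (1 + x)) + (1 - p) * (1 - 1 / (1 + gamma \<pi> ^ (m-2) * x)) \<le> sup_U_R m p \<pi>"
proof -
  have "lbar \<pi> \<in> range (lratio \<pi>)" "lunder \<pi> \<in> range (lratio \<pi>)"
    unfolding lbar_def lunder_def by (auto intro!: Max_in Min_in)
  then obtain h l where h: "lratio \<pi> h = lbar \<pi>" and l: "lratio \<pi> l = lunder \<pi>"
    by (metis imageE)
  have hl: "h \<noteq> l"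
    using h l gam lbar_pos[of \<pi>] pos by (auto simp: gamma_def)
  define \<rho> where "\<rho> th = \<pi> th l / \<pi> th h" for th
  have \<rho>_pos: "0 < \<rho> th" for th
    by (simp add: \<rho>_def pos)
  have \<rho>L: "\<rho> L = gamma \<pi> * \<rho> H"
    using pos[of H h] pos[of L h] pos[of H l] pos[of L l]
    by (simp add: gamma_def \<rho>_def h[symmetric] l[symmetric] lratio_def)
  \<comment> \<open>With this choice the odds of ending in 1 rather than \<open>m\<close> tend to
    \<open>x\<close> under \<open>H\<close> as the exits become rare, and to
    \<open>gamma \<pi> ^ (m-2) * x\<close> under \<open>L\<close>.\<close>
  define \<omega> where "\<omega> = \<rho> H ^ (m-2) / x"
  have \<omega>_pos: "0 < \<omega>" and \<omega>_eq: "\<rho> H ^ (m-2) / \<omega> = x" "\<rho> L ^ (m-2) / \<omega> = gamma \<pi> ^ (m-2) * x"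
    using \<rho>_pos[of H] x by (simp_all add: \<omega>_def \<rho>L power_mult_distrib)
  define S where "S th = (\<Sum>k\<in>{2..<m-1}. \<rho> th ^ (k-1))" for th
  define u where "u \<delta> = p * (1 / (1 + \<delta> * S H + x)) + (1 - p) * (1 - 1 / (1 + \<delta> * S L + gamma \<pi> ^ (m-2) * x))" for \<delta>
  have le: "u \<delta> \<le> sup_U_R m p \<pi>" if \<delta>: "0 < \<delta>" "\<delta> < min 1 (1 / \<omega>)" for \<delta>
  proof -
    interpret birth_death m \<pi> h l \<delta> \<omega>
      using m4 pos sum1 hl \<delta> \<omega>_pos by unfold_locales (auto simp: field_simps)
    have "hit th m = 1 / (1 + \<delta> * S th + \<rho> th ^ (m-2) / \<omega>)" for th
      unfolding S_def \<rho>_def by (rule hit_eq_ladder)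
    then have "hit H m = 1 / (1 + \<delta> * S H + x)" "hit L m = 1 / (1 + \<delta> * S L + gamma \<pi> ^ (m-2) * x)"
      by (simp_all only: \<omega>_eq)
    moreover have "hit L 1 = 1 - hit L m"
      using hit_sum[of L] by simp
    ultimately have "U_R m p \<pi> walk start act = u \<delta>"
      by (simp only: U_R_eq[OF p] u_def)
    then show ?thesis
      using U_R_le_sup_U_R[where \<pi>=\<pi>, OF pos sum1 p walk_protocol] by simp
  qed
  \<comment> \<open>The value at \<open>\<delta> = 0\<close> belongs to no walk of the family; it
    bounds the supremum only as a limit.\<close>
  have "(u \<longlongrightarrow> u 0) (at_right 0)"
    unfolding u_def using x gam p by (auto intro!: tendsto_eq_intros simp: add_pos_pos less_imp_neq[symmetric])
  moreover have "eventually (\<lambda>\<delta>. u \<delta> \<le> sup_U_R m p \<pi>) (at_right 0)"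
    using \<omega>_pos le by (auto simp: eventually_at_right_field intro!: exI[of _ "min 1 (1 / \<omega>)"])
  ultimately have "u 0 \<le> sup_U_R m p \<pi>"
    by (intro tendsto_upperbound) auto
  then show ?thesis
    by (simp add: u_def)
qed

section \<open>Optimal error probabilities and the limit\<close>

text \<open>If all likelihood ratios agreed, the two signal distributions would be proportional and,
  having the same total, equal.\<close>

lemma gamma_gt_1:
  fixes \<pi> :: "theta \<Rightarrow> 's::finite \<Rightarrow> real"
  assumes pos: "\<And>th s. 0 < \<pi> th s" and sum1: "\<And>th. (\<Sum>s\<in>UNIV. \<pi> th s) = 1" and diff: "\<pi> H \<noteq> \<pi> L"
  shows "1 < gamma \<pi>"
proof (rule ccontr)
  assume "\<not> 1 < gamma \<pi>"
  then have le: "lbar \<pi> \<le> lunder \<pi>"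
    using lunder_pos[of \<pi>] pos by (simp add: gamma_def not_less divide_le_eq)
  have "lratio \<pi> s = lunder \<pi>" for s
    using le lunder_le[of \<pi> s] le_lbar[of \<pi> s] pos by force
  then have H: "\<pi> H s = lunder \<pi> * \<pi> L s" for s
    using pos[of L s] by (simp add: lratio_def divide_eq_eq)
  have "(\<Sum>s\<in>UNIV. \<pi> H s) = lunder \<pi> * (\<Sum>s\<in>UNIV. \<pi> L s)"
    by (simp add: H sum_distrib_left)
  then have "lunder \<pi> = 1"
    by (simp add: sum1)
  then have "\<pi> H = \<pi> L"
    by (auto simp: H)
  then show False
    using diff by simp
qed

lemma signal_gap:
  fixes \<pi> :: "theta \<Rightarrow> 's::finite \<Rightarrow> real"
  assumes pos: "\<And>th s. 0 < \<pi> th s" and gam: "1 < gamma \<pi>"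
  obtains C where "1 < C" "C < gamma \<pi>"
    "\<And>s. s \<notin> lsig \<pi> \<Longrightarrow> C * lunder \<pi> \<le> lratio \<pi> s" "\<And>s. s \<notin> hsig \<pi> \<Longrightarrow> C * lratio \<pi> s \<le> lbar \<pi>"
proof -
  note b = lunder_pos[of \<pi>] lunder_le[of \<pi>] le_lbar[of \<pi>]
  have lr: "0 < lratio \<pi> s" for s
    by (simp add: lratio_def pos)
  \<comment> \<open>Finitely many numbers above 1. Including \<open>gamma \<pi>\<close> makes the
    set nonempty and keeps \<open>C\<close> below \<open>gamma \<pi>\<close>, which leaves room for
    \<open>\<eta> * C \<le> gamma \<pi>\<close>.\<close>
  define X where "X = insert (gamma \<pi>)
    ((\<lambda>s. lratio \<pi> s / lunder \<pi>) ` (- lsig \<pi>) \<union> (\<lambda>s. lbar \<pi> / lratio \<pi> s) ` (- hsig \<pi>))"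
  have fin: "finite X"
    by (simp add: X_def)
  have "1 < lratio \<pi> s / lunder \<pi>" if "s \<notin> lsig \<pi>" for s
    using that b(1) b(2)[of s] pos by (auto simp: lsig_def less_le)
  moreover have "1 < lbar \<pi> / lratio \<pi> s" if "s \<notin> hsig \<pi>" for s
    using that b(3)[of s] lr[of s] pos by (auto simp: hsig_def less_le)
  ultimately have "1 < Min X"
    using gam fin by (auto simp: X_def)
  then obtain C where C: "1 < C" "C < Min X"
    using dense by blast
  then have less: "C < x" if "x \<in> X" for x
    using C(2) Min_le[OF fin that] by linarith
  show ?thesis
  proof (rule that[of C])
    show "C < gamma \<pi>"
      by (rule less) (simp add: X_def)
    show "C * lunder \<pi> \<le> lratio \<pi> s" if "s \<notin> lsig \<pi>" for s
    proof -
      have "C < lratio \<pi> s / lunder \<pi>"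
        by (rule less) (use that in \<open>auto simp: X_def\<close>)
      then show ?thesis
        using b(1) pos by (simp add: less_divide_eq)
    qed
    show "C * lratio \<pi> s \<le> lbar \<pi>" if "s \<notin> hsig \<pi>" for s
    proof -
      have "C < lbar \<pi> / lratio \<pi> s"
        by (rule less) (use that in \<open>auto simp: X_def\<close>)
      then show ?thesis
        using lr[of s] by (simp add: less_divide_eq)
    qed
  qed (rule C)
qed

text \<open>With error probabilities \<open>x\<close> and \<open>y\<close>, the odds bound \<open>(1-x)(1-y) \<le> \<Gamma> x y\<close> reads
  \<open>(1+(\<Gamma>-1)x) (1+(\<Gamma>-1)y) \<ge> \<Gamma>\<close>. By AM-GM the expected error \<open>p x + (1-p) y\<close> is then smallest at the
  point where \<open>p (1+(\<Gamma>-1)x) = (1-p) (1+(\<Gamma>-1)y) = c\<close>.\<close>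

locale error_tradeoff =
  fixes p \<Gamma> :: real
  assumes p: "0 < p" "p < 1" and \<Gamma>: "kappa p < \<Gamma>"
begin

definition c :: real where "c = sqrt (p * (1 - p) * \<Gamma>)"
definition errH :: real where "errH = (c / p - 1) / (\<Gamma> - 1)"
definition errL :: real where "errL = (c / (1 - p) - 1) / (\<Gamma> - 1)"

lemma \<Gamma>_bounds: "p < (1 - p) * \<Gamma>" "1 - p < p * \<Gamma>"
  using p \<Gamma> by (auto simp: kappa_def divide_less_eq mult.commute)

lemma \<Gamma>_gt_1: "1 < \<Gamma>"
proof -
  have "1 < p * \<Gamma> + (1 - p) * \<Gamma>"
    using \<Gamma>_bounds by linarith
  then show ?thesis
    by (simp add: algebra_simps)
qed

lemma c_sq: "c\<^sup>2 = p * (1 - p) * \<Gamma>" and c_pos: "0 < c"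
  using p \<Gamma>_gt_1 by (simp_all add: c_def)

lemma c_gt: "p < c" "1 - p < c" and c_less: "c < p * \<Gamma>" "c < (1 - p) * \<Gamma>"
proof -
  have pp: "p\<^sup>2 < c\<^sup>2" "(1 - p)\<^sup>2 < c\<^sup>2" "c\<^sup>2 < (p * \<Gamma>)\<^sup>2" "c\<^sup>2 < ((1 - p) * \<Gamma>)\<^sup>2"
  proof -
    show "p\<^sup>2 < c\<^sup>2"
      using mult_strict_left_mono[OF \<Gamma>_bounds(1) p(1)] unfolding c_sq unfolding power2_eq_square by (simp add: ac_simps)
    show "(1 - p)\<^sup>2 < c\<^sup>2"
      using mult_strict_left_mono[OF \<Gamma>_bounds(2), of "1 - p"] p unfolding c_sq unfolding power2_eq_square by (simp add: ac_simps)
    show "c\<^sup>2 < (p * \<Gamma>)\<^sup>2"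
      using mult_strict_left_mono[OF \<Gamma>_bounds(2), of "p * \<Gamma>"] p \<Gamma>_gt_1 unfolding c_sq unfolding power2_eq_square by (simp add: ac_simps)
    show "c\<^sup>2 < ((1 - p) * \<Gamma>)\<^sup>2"
      using mult_strict_left_mono[OF \<Gamma>_bounds(1), of "(1 - p) * \<Gamma>"] p \<Gamma>_gt_1 unfolding c_sq unfolding power2_eq_square by (simp add: ac_simps)
  qed
  show "p < c" "1 - p < c" "c < p * \<Gamma>" "c < (1 - p) * \<Gamma>"
    using pp p c_pos \<Gamma>_gt_1 by (auto intro: power_less_imp_less_base[where n=2])
qed

text \<open>The minimizer is interior: \<open>kappa p < \<Gamma>\<close> puts \<open>c\<close>
  strictly above both prior weights and strictly below \<open>\<Gamma>\<close> times each of
  them.\<close>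

lemma err_bounds: "0 < errH" "errH < 1" "0 < errL" "errL < 1"
  using c_gt c_less p \<Gamma>_gt_1 by (auto simp: errH_def errL_def field_simps)

lemma err_affine: "1 + (\<Gamma> - 1) * errH = c / p" "1 + (\<Gamma> - 1) * errL = c / (1 - p)"
  using \<Gamma>_gt_1 by (simp_all add: errH_def errL_def)

lemma err_odds: "(1 - errH) * (1 - errL) = \<Gamma> * (errH * errL)"
proof -
  have "(1 + (\<Gamma> - 1) * errH) * (1 + (\<Gamma> - 1) * errL) = \<Gamma>"
    unfolding err_affine using p c_sq by (simp add: power2_eq_square)
  then have "(\<Gamma> - 1) * (errH + errL + (\<Gamma> - 1) * (errH * errL)) = (\<Gamma> - 1) * 1"
    by (simp add: algebra_simps)
  then have "errH + errL + (\<Gamma> - 1) * (errH * errL) = 1"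
    using \<Gamma>_gt_1 by (subst (asm) mult_cancel_left) auto
  then show ?thesis
    by (simp add: algebra_simps)
qed

lemma err_value: "(\<Gamma> - 1) * (p * errH + (1 - p) * errL) = 2 * c - 1"
proof -
  have "p * (1 + (\<Gamma> - 1) * errH) + (1 - p) * (1 + (\<Gamma> - 1) * errL) = 2 * c"
    unfolding err_affine using p by simp
  then show ?thesis
    by (simp add: algebra_simps)
qed

text \<open>The gap in AM-GM controls the distance of the factors:
  \<open>(u - v)^2 = (u + v)^2 - 4 u v\<close>, and \<open>u v\<close> is at least
  \<open>c^2\<close>. A sum tending to \<open>2 c\<close> therefore forces both factors to tend to
  \<open>c\<close>.\<close>

lemma errors_converge:
  fixes X Y :: "nat \<Rightarrow> real"
  assumes nonneg: "\<And>n. 0 \<le> X n" "\<And>n. 0 \<le> Y n"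
    and odds: "\<And>n. (1 - X n) * (1 - Y n) \<le> \<Gamma> * (X n * Y n)"
    and lim: "(\<lambda>n. p * X n + (1 - p) * Y n) \<longlonglongrightarrow> e" and e: "e \<le> p * errH + (1 - p) * errL"
  shows "X \<longlonglongrightarrow> errH" "Y \<longlonglongrightarrow> errL"
proof -
  define u where "u n = p * (1 + (\<Gamma> - 1) * X n)" for n
  define v where "v n = (1 - p) * (1 + (\<Gamma> - 1) * Y n)" for n
  have uv_nonneg: "0 \<le> u n" "0 \<le> v n" for n
    using p \<Gamma>_gt_1 nonneg[of n] by (auto simp: u_def v_def)
  have prod: "c\<^sup>2 \<le> u n * v n" for n
  proof -
    have "1 \<le> X n + Y n + (\<Gamma> - 1) * (X n * Y n)"
      using odds[of n] by (simp add: algebra_simps)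
    then have "(\<Gamma> - 1) * 1 \<le> (\<Gamma> - 1) * (X n + Y n + (\<Gamma> - 1) * (X n * Y n))"
      using \<Gamma>_gt_1 by (intro mult_left_mono) auto
    then have "\<Gamma> \<le> (1 + (\<Gamma> - 1) * X n) * (1 + (\<Gamma> - 1) * Y n)"
      by (simp add: algebra_simps)
    then have "p * (1 - p) * \<Gamma> \<le> p * (1 - p) * ((1 + (\<Gamma> - 1) * X n) * (1 + (\<Gamma> - 1) * Y n))"
      using p by (intro mult_left_mono) auto
    then show ?thesis
      by (simp add: c_sq u_def v_def ac_simps)
  qed
  have diff_sq: "(u n - v n)\<^sup>2 \<le> (u n + v n)\<^sup>2 - (2 * c)\<^sup>2" for n
    using prod[of n] by (simp add: power2_eq_square algebra_simps)
  have sum_ge: "2 * c \<le> u n + v n" for n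
  proof -
    have "(2 * c)\<^sup>2 \<le> (u n + v n)\<^sup>2"
      using diff_sq[of n] zero_le_power2[of "u n - v n"] by linarith
    then show ?thesis
      by (rule power2_le_imp_le) (use uv_nonneg[of n] in simp)
  qed
  define q where "q = 1 + (\<Gamma> - 1) * e"
  have "(\<lambda>n. 1 + (\<Gamma> - 1) * (p * X n + (1 - p) * Y n)) \<longlonglongrightarrow> q"
    unfolding q_def by (intro tendsto_intros lim)
  moreover have "1 + (\<Gamma> - 1) * (p * X n + (1 - p) * Y n) = u n + v n" for n
    by (simp add: u_def v_def algebra_simps)
  ultimately have sum_lim: "(\<lambda>n. u n + v n) \<longlonglongrightarrow> q"
    by simp
  \<comment> \<open>Only an upper bound for \<open>e\<close> is assumed; the matching lower bound
    comes from the odds inequality.\<close>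
  have "2 * c \<le> q"
    by (rule tendsto_lowerbound[OF sum_lim]) (simp_all add: sum_ge)
  moreover have "(\<Gamma> - 1) * e \<le> 2 * c - 1"
    unfolding err_value[symmetric] using e \<Gamma>_gt_1 by (intro mult_left_mono) auto
  ultimately have q: "q = 2 * c"
    by (simp add: q_def)
  have "(\<lambda>n. (u n + v n)\<^sup>2 - (2 * c)\<^sup>2) \<longlonglongrightarrow> q\<^sup>2 - (2 * c)\<^sup>2"
    by (intro tendsto_intros sum_lim)
  then have up: "(\<lambda>n. (u n + v n)\<^sup>2 - (2 * c)\<^sup>2) \<longlonglongrightarrow> 0"
    by (simp add: q)
  have "(\<lambda>n. (u n - v n)\<^sup>2) \<longlonglongrightarrow> 0"
    by (rule tendsto_sandwich[OF _ _ tendsto_const up]) (intro always_eventually allI diff_sq zero_le_power2)+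
  then have diff_lim: "(\<lambda>n. u n - v n) \<longlonglongrightarrow> 0"
    by simp
  have "(\<lambda>n. ((u n + v n) + (u n - v n)) / 2) \<longlonglongrightarrow> (q + 0) / 2"
    by (intro tendsto_intros sum_lim diff_lim) simp
  then have ul: "u \<longlonglongrightarrow> c"
    by (simp add: q)
  have "(\<lambda>n. ((u n + v n) - (u n - v n)) / 2) \<longlonglongrightarrow> (q - 0) / 2"
    by (intro tendsto_intros sum_lim diff_lim) simp
  then have vl: "v \<longlonglongrightarrow> c"
    by (simp add: q)
  have "(\<lambda>n. (u n / p - 1) / (\<Gamma> - 1)) \<longlonglongrightarrow> errH"
    unfolding errH_def using p \<Gamma>_gt_1 by (intro tendsto_intros ul) auto
  then show "X \<longlonglongrightarrow> errH"
    using p \<Gamma>_gt_1 by (simp add: u_def)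
  have "(\<lambda>n. (v n / (1 - p) - 1) / (\<Gamma> - 1)) \<longlonglongrightarrow> errL"
    unfolding errL_def using p \<Gamma>_gt_1 by (intro tendsto_intros vl) auto
  then show "Y \<longlonglongrightarrow> errL"
    using p \<Gamma>_gt_1 by (simp add: v_def)
qed

end

lemma transient_chain_of_parsimonious:
  assumes m4: "4 \<le> m" and pos: "\<And>th s. 0 < \<pi> th s" and sum1: "\<And>th. (\<Sum>s\<in>UNIV. \<pi> th s) = 1"
    and prot: "is_protocol m f g a" and pars: "parsimonious m \<pi> f a"
    and ends: "absorbing m f 1" "a 1 = 0" "absorbing m f m" "a m = 1" and g: "g 1 = 0" "g m = 0"
  shows "transient_chain m \<pi> f g a"
proof -
  obtain a0 a1 where as: "a a0 = 0" "a a1 = 1"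
    and abs: "\<And>i. i \<in> {1..m} \<Longrightarrow> absorbing m f i \<Longrightarrow> i = a0 \<or> i = a1"
    and tr: "\<And>i th. i \<in> {1..m} - {a0, a1} \<Longrightarrow> transient m \<pi> th f i \<and> a i = 0"
    using pars unfolding parsimonious_def by blast
  have "1 = a0 \<or> 1 = a1" "m = a0 \<or> m = a1"
    using abs[of 1] abs[of m] ends m4 by auto
  \<comment> \<open>The values of \<open>a\<close> at the two absorbing states exclude the swapped
    labelling.\<close>
  then have a01: "a0 = 1" "a1 = m"
    using as ends by auto
  interpret exit_chain m \<pi> f g a
  proof
    show "\<not> absorbing m f i" if "i \<in> {2..m-1}" for i
    proof -
      have "i \<in> {1..m}" "i \<noteq> 1" "i \<noteq> m"
        using that m4 by auto
      then show ?thesis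
        using abs a01 by blast
    qed
    show "a i = 0" if "i \<in> {2..m-1}" for i
    proof -
      have "i \<in> {1..m}" "i \<noteq> 1" "i \<noteq> m"
        using that m4 by auto
      then show ?thesis
        using tr[of i] a01 by blast
    qed
  qed (use m4 pos sum1 prot ends g in auto)
  show ?thesis
  proof
    show "summable (\<lambda>t. alive th t i)" if "i \<in> T" for th i
    proof (rule summable_alive_of_transient[OF _ that])
      fix k assume "k \<in> T"
      then have "k \<in> {1..m} - {1, m}"
        by auto
      then show "transient m \<pi> th f k"
        using tr a01 by blast
    qed
  qed
qed

theorem theorem4:
  fixes p :: real and \<pi> :: "theta \<Rightarrow> 's::finite \<Rightarrow> real" and m :: nat
    and F :: "nat \<Rightarrow> nat \<Rightarrow> 's \<Rightarrow> nat \<Rightarrow> real"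
    and G :: "nat \<Rightarrow> nat \<Rightarrow> real"
    and A :: "nat \<Rightarrow> nat \<Rightarrow> real"
  assumes p: "0 < p" "p < 1"
    and pi_pos: "\<forall>th s. \<pi> th s > 0"
    and pi_sum: "\<forall>th. (\<Sum>s\<in>UNIV. \<pi> th s) = 1"
    and pi_diff: "\<pi> H \<noteq> \<pi> L"
    and m4: "m \<ge> 4"
    and gk: "gamma \<pi> ^ (m - 2) > kappa p"
    and prot: "\<forall>n. is_protocol m (F n) (G n) (A n)"
    and pars: "\<forall>n. parsimonious m \<pi> (F n) (A n)"
    and lab1: "\<forall>n. absorbing m (F n) 1 \<and> A n 1 = 0"
    and labm: "\<forall>n. absorbing m (F n) m \<and> A n m = 1"
    and g_supp: "\<forall>n. G n 1 = 0 \<and> G n m = 0"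
    and visits_pos: "\<forall>n th. \<forall>i\<in>{2..m-1}. exp_visits m \<pi> th (F n) (G n) i > 0"
    and order: "\<forall>n. \<forall>i j. 2 \<le> i \<and> i \<le> j \<and> j \<le> m - 1 \<longrightarrow>
                  nu m \<pi> H (F n) (G n) i / nu m \<pi> L (F n) (G n) i
                  \<le> nu m \<pi> H (F n) (G n) j / nu m \<pi> L (F n) (G n) j"
    and opt: "(\<lambda>n. U_R m p \<pi> (F n) (G n) (A n)) \<longlonglongrightarrow> sup_U_R m p \<pi>"
  shows "(\<forall>th. (\<lambda>n. last_step_prob m \<pi> th (F n) (G n) 2 (lsig \<pi>) 1
                       / absorb_prob m \<pi> th (F n) (G n) 1) \<longlonglongrightarrow> 1
            \<and> (\<lambda>n. last_step_prob m \<pi> th (F n) (G n) (m - 1) (hsig \<pi>) m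
                       / absorb_prob m \<pi> th (F n) (G n) m) \<longlonglongrightarrow> 1)
       \<and> (\<forall>i\<in>{2..m-1}. \<forall>s. (\<lambda>n. F n i s 1 + F n i s m) \<longlonglongrightarrow> 0)"
proof -
  have pos: "0 < \<pi> th s" and sum1: "(\<Sum>s\<in>UNIV. \<pi> th s) = 1" for th s
    using pi_pos pi_sum by auto
  have gam: "1 < gamma \<pi>"
    using gamma_gt_1[of \<pi>] pos sum1 pi_diff by blast
  obtain C where C: "1 < C" "C < gamma \<pi>"
    and C_low: "\<And>s. s \<notin> lsig \<pi> \<Longrightarrow> C * lunder \<pi> \<le> lratio \<pi> s"
    and C_high: "\<And>s. s \<notin> hsig \<pi> \<Longrightarrow> C * lratio \<pi> s \<le> lbar \<pi>"
    using signal_gap[where \<pi>=\<pi>, OF pos gam] by blast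
  define \<Gamma> where "\<Gamma> = gamma \<pi> ^ (m - 2)"
  interpret error_tradeoff p \<Gamma>
    using p gk by unfold_locales (simp_all add: \<Gamma>_def)

  have chain: "ordered_chain m \<pi> (F n) (G n) (A n)" for n
  proof -
    interpret transient_chain m \<pi> "F n" "G n" "A n"
      using m4 pos sum1 prot pars lab1 labm g_supp by (intro transient_chain_of_parsimonious) auto
    have v: "0 < visits th i" if "i \<in> T" for th i
      using visits_pos that by auto
    have tau: "0 < exp_tau m \<pi> th (F n) (G n)" for th
      unfolding exp_tau_eq using v m4 by (intro sum_pos) auto
    have nu: "nu m \<pi> H (F n) (G n) i / nu m \<pi> L (F n) (G n) i = visits H i / visits L i
        * (exp_tau m \<pi> L (F n) (G n) / exp_tau m \<pi> H (F n) (G n))" for i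
      by (simp add: nu_def)
    show ?thesis
    proof
      show "visits H i / visits L i \<le> visits H j / visits L j" if "2 \<le> i" "i \<le> j" "j \<le> m - 1" for i j
      proof -
        have "nu m \<pi> H (F n) (G n) i / nu m \<pi> L (F n) (G n) i
            \<le> nu m \<pi> H (F n) (G n) j / nu m \<pi> L (F n) (G n) j"
          using order that by blast
        then show ?thesis
          unfolding nu using tau by (subst (asm) mult_le_cancel_right_pos) auto
      qed
    qed (use v in auto)
  qed

  define X where "X n = absorb_prob m \<pi> H (F n) (G n) 1" for n
  define Y where "Y n = absorb_prob m \<pi> L (F n) (G n) m" for n
  have hits: "0 \<le> X n" "0 \<le> Y n" "absorb_prob m \<pi> H (F n) (G n) m = 1 - X n"
    "absorb_prob m \<pi> L (F n) (G n) 1 = 1 - Y n"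
    and odds: "(1 - X n) * (1 - Y n) \<le> \<Gamma> * (X n * Y n)"
    and payoff: "U_R m p \<pi> (F n) (G n) (A n) = 1 - (p * X n + (1 - p) * Y n)" for n
  proof -
    interpret ordered_chain m \<pi> "F n" "G n" "A n"
      by (rule chain)
    show 1: "absorb_prob m \<pi> H (F n) (G n) m = 1 - X n" "absorb_prob m \<pi> L (F n) (G n) 1 = 1 - Y n"
      using hit_sum[of H] hit_sum[of L] by (simp_all add: X_def Y_def)
    show "0 \<le> X n" "0 \<le> Y n"
      using hit_nonneg by (simp_all add: X_def Y_def)
    show "(1 - X n) * (1 - Y n) \<le> \<Gamma> * (X n * Y n)"
      using odds_le unfolding 1 \<Gamma>_def X_def Y_def by (simp add: ac_simps)
    show "U_R m p \<pi> (F n) (G n) (A n) = 1 - (p * X n + (1 - p) * Y n)"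
      unfolding U_R_eq[OF p] 1 by (simp add: algebra_simps)
  qed

  have sup_ge: "1 - (p * errH + (1 - p) * errL) \<le> sup_U_R m p \<pi>"
  proof -
    \<comment> \<open>The optimal error odds under \<open>H\<close>; by \<open>err_odds\<close>,
      \<open>\<Gamma> * x\<close> are then the odds of a correct action under
      \<open>L\<close>.\<close>
    define x where "x = errH / (1 - errH)"
    have "\<Gamma> * x = (1 - errL) / errL"
      using err_odds err_bounds by (simp add: x_def field_simps)
    then have "1 + \<Gamma> * x = 1 / errL" "1 + x = 1 / (1 - errH)" "0 < x"
      using err_bounds by (simp_all add: x_def field_simps)
    then show ?thesis
      using sup_U_R_ge[where \<pi>=\<pi>, OF m4 pos sum1 gam p, of x] unfolding \<Gamma>_def[symmetric]
      by (simp add: algebra_simps)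
  qed
  have "(\<lambda>n. 1 - U_R m p \<pi> (F n) (G n) (A n)) \<longlonglongrightarrow> 1 - sup_U_R m p \<pi>"
    by (intro tendsto_intros opt)
  then have "(\<lambda>n. p * X n + (1 - p) * Y n) \<longlonglongrightarrow> 1 - sup_U_R m p \<pi>"
    by (simp add: payoff)
  then have X: "X \<longlonglongrightarrow> errH" and Y: "Y \<longlonglongrightarrow> errL"
    using errors_converge[of X Y] hits(1,2) odds sup_ge by auto

  \<comment> \<open>The exact defect of the odds bound. It tends to 1 because the limiting errors
    satisfy the bound with equality.\<close>
  define \<eta> where "\<eta> n = \<Gamma> * (X n * Y n) / ((1 - X n) * (1 - Y n))" for n
  define \<epsilon> where "\<epsilon> n = (\<eta> n - 1) * C / (C - 1)" for n
  \<comment> \<open>Half of the smaller limiting absorption probability under \<open>L\<close>,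
    hence eventually a common lower bound for both.\<close>
  define b where "b = min errL (1 - errL) / 2"
  have "\<eta> \<longlonglongrightarrow> \<Gamma> * (errH * errL) / ((1 - errH) * (1 - errL))"
    unfolding \<eta>_def using err_bounds by (intro tendsto_intros X Y) auto
  then have \<eta>_lim: "\<eta> \<longlonglongrightarrow> 1"
    using err_bounds unfolding err_odds[symmetric] by simp
  have "\<epsilon> \<longlonglongrightarrow> (1 - 1) * C / (C - 1)"
    unfolding \<epsilon>_def using C by (intro tendsto_intros \<eta>_lim) auto
  then have \<epsilon>_lim: "\<epsilon> \<longlonglongrightarrow> 0"
    by simp
  have b: "0 < b" "b < errL" "b < 1 - errL"
    using err_bounds by (auto simp: b_def min_def)

  have "1 < gamma \<pi> / C"
    using C by simp
  then have "eventually (\<lambda>n. 0 < X n) sequentially" "eventually (\<lambda>n. X n < 1) sequentially"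
    "eventually (\<lambda>n. b < Y n) sequentially" "eventually (\<lambda>n. Y n < 1 - b) sequentially"
    "eventually (\<lambda>n. \<eta> n < gamma \<pi> / C) sequentially" "eventually (\<lambda>n. \<epsilon> n < 1) sequentially"
    using order_tendstoD[OF X] order_tendstoD[OF Y] order_tendstoD[OF \<eta>_lim] order_tendstoD[OF \<epsilon>_lim]
      err_bounds b by auto
  then have good: "eventually (\<lambda>n. 0 < X n \<and> X n < 1 \<and> b < Y n \<and> Y n < 1 - b \<and> \<epsilon> n < 1
      \<and> 1 \<le> \<eta> n \<and> tight_chain m \<pi> (F n) (G n) (A n) (\<eta> n) C) sequentially"
  proof eventually_elim
    case (elim n)
    interpret ordered_chain m \<pi> "F n" "G n" "A n"
      by (rule chain)
    have pq: "0 < (1 - X n) * (1 - Y n)"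
      using elim b by auto
    have "\<eta> n * ((1 - X n) * (1 - Y n)) = \<Gamma> * (X n * Y n)"
      by (rule iffD1[OF nonzero_eq_divide_eq, OF _ \<eta>_def]) (rule less_imp_neq[OF pq, symmetric])
    then have \<eta>: "\<Gamma> * (Y n * X n) = \<eta> n * ((1 - X n) * (1 - Y n))"
      by (simp only: mult.commute)
    have "1 \<le> \<eta> n"
      using odds[of n] pq by (simp add: \<eta>_def)
    moreover have "tight_chain m \<pi> (F n) (G n) (A n) (\<eta> n) C"
    proof
      show "\<eta> n * C \<le> gamma \<pi>"
        using elim C by (simp add: less_divide_eq)
      show "gamma \<pi> ^ (m-2) * (hit L m * hit H 1) \<le> \<eta> n * (hit H m * hit L 1)"
        unfolding hits(3,4) X_def[symmetric] Y_def[symmetric] \<Gamma>_def[symmetric] \<eta> ..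
      show "0 < hit L m" "0 < hit L 1"
        using elim b unfolding hits(3,4) Y_def[symmetric] by auto
    qed (use \<open>1 \<le> \<eta> n\<close> C C_low C_high in auto)
    ultimately show ?case
      using elim by simp
  qed

  have low_lim: "(\<lambda>n. (1 - \<epsilon> n) / \<eta> n) \<longlonglongrightarrow> 1"
  proof -
    have "(\<lambda>n. (1 - \<epsilon> n) / \<eta> n) \<longlonglongrightarrow> (1 - 0) / 1"
      by (intro tendsto_intros \<epsilon>_lim \<eta>_lim) simp
    then show ?thesis
      by simp
  qed
  have high_lim: "(\<lambda>n. 1 - \<epsilon> n) \<longlonglongrightarrow> 1"
    using tendsto_diff[OF tendsto_const \<epsilon>_lim, of 1] by simp

  have bounds: "eventually (\<lambda>n.
      (\<forall>th. (1 - \<epsilon> n) / \<eta> n \<le> last_step_prob m \<pi> th (F n) (G n) 2 (lsig \<pi>) 1 / absorb_prob m \<pi> th (F n) (G n) 1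
        \<and> last_step_prob m \<pi> th (F n) (G n) 2 (lsig \<pi>) 1 / absorb_prob m \<pi> th (F n) (G n) 1 \<le> 1
        \<and> 1 - \<epsilon> n \<le> last_step_prob m \<pi> th (F n) (G n) (m-1) (hsig \<pi>) m / absorb_prob m \<pi> th (F n) (G n) m
        \<and> last_step_prob m \<pi> th (F n) (G n) (m-1) (hsig \<pi>) m / absorb_prob m \<pi> th (F n) (G n) m \<le> 1)
      \<and> (\<forall>i\<in>{2..m-1}. \<forall>s. 0 \<le> F n i s 1 + F n i s m
        \<and> F n i s 1 + F n i s m \<le> 2 * \<epsilon> n / ((1 - \<epsilon> n)\<^sup>2 * b * \<pi> L s))) sequentially"
    using good
  proof eventually_elim
    case (elim n)
    interpret tight_chain m \<pi> "F n" "G n" "A n" "\<eta> n" C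
      using elim by blast
    have slack: "slack = \<epsilon> n"
      by (simp add: slack_def \<epsilon>_def)
    have hit_pos: "0 < hit th 1" "0 < hit th m" for th
      using elim b hits(3,4)[of n] by (cases th; simp add: X_def Y_def)+
    have T2: "2 \<in> T" "m - 1 \<in> T"
      using m4 by auto
    have le1: "\<epsilon> n \<le> 1"
      using elim by simp
    show ?case
    proof (intro conjI allI ballI)
      fix th
      show "(1 - \<epsilon> n) / \<eta> n \<le> last_step_prob m \<pi> th (F n) (G n) 2 (lsig \<pi>) 1 / hit th 1"
        using last_step_low[of th] le1 elim hit_pos[of th]
        by (simp add: slack pos_le_divide_eq pos_divide_le_eq mult.commute)
      show "1 - \<epsilon> n \<le> last_step_prob m \<pi> th (F n) (G n) (m-1) (hsig \<pi>) m / hit th m"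
        using last_step_high[of th] le1 hit_pos[of th] by (simp add: slack pos_le_divide_eq)
      show "last_step_prob m \<pi> th (F n) (G n) 2 (lsig \<pi>) 1 / hit th 1 \<le> 1"
        "last_step_prob m \<pi> th (F n) (G n) (m-1) (hsig \<pi>) m / hit th m \<le> 1"
        using last_step_le_hit T2 hit_pos[of th] by simp_all
    next
      fix i s assume i: "i \<in> T"
      show "0 \<le> F n i s 1 + F n i s m"
        using i by (intro add_nonneg_nonneg f_nonneg_T)
      have "b \<le> hit L 1" "b \<le> hit L m"
        using elim hits(4)[of n] by (simp_all add: Y_def)
      moreover have "0 < (1 - \<epsilon> n)\<^sup>2 * b * \<pi> L s"
        using elim b pos by simp
      ultimately show "F n i s 1 + F n i s m \<le> 2 * \<epsilon> n / ((1 - \<epsilon> n)\<^sup>2 * b * \<pi> L s)"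
        using exit_prob_le[OF i, of b s] le1 by (simp add: slack pos_le_divide_eq)
    qed
  qed
  show ?thesis
  proof (intro conjI allI ballI)
    fix th
    show "(\<lambda>n. last_step_prob m \<pi> th (F n) (G n) 2 (lsig \<pi>) 1 / absorb_prob m \<pi> th (F n) (G n) 1) \<longlonglongrightarrow> 1"
      by (rule tendsto_sandwich[OF _ _ low_lim tendsto_const]; rule eventually_mono[OF bounds]) auto
    show "(\<lambda>n. last_step_prob m \<pi> th (F n) (G n) (m-1) (hsig \<pi>) m / absorb_prob m \<pi> th (F n) (G n) m) \<longlonglongrightarrow> 1"
      by (rule tendsto_sandwich[OF _ _ high_lim tendsto_const]; rule eventually_mono[OF bounds]) auto
  next
    fix i s assume i: "i \<in> {2..m-1}"
    have "(\<lambda>n. 2 * \<epsilon> n / ((1 - \<epsilon> n)\<^sup>2 * b * \<pi> L s)) \<longlonglongrightarrow> 2 * 0 / ((1 - 0)\<^sup>2 * b * \<pi> L s)"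
      using b pos[of L s] by (intro tendsto_intros \<epsilon>_lim) auto
    then have lim: "(\<lambda>n. 2 * \<epsilon> n / ((1 - \<epsilon> n)\<^sup>2 * b * \<pi> L s)) \<longlonglongrightarrow> 0"
      by simp
    show "(\<lambda>n. F n i s 1 + F n i s m) \<longlonglongrightarrow> 0"
      by (rule tendsto_sandwich[OF _ _ tendsto_const lim]; rule eventually_mono[OF bounds]) (use i in auto)
  qed
qed

end
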